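(* In the symmetric-ordering setup, for all $f\in S(\mathfrak g)$ and all indices $\mu,\nu$, $$M_\mu(x_\nu\star f)-x_\nu\star(M_\mu f)=\Big(\sum_\lambda C^\lambda_{\mu\nu}x_\lambda\Big)f+\sum_\tau M_\tau\big(\chi^\tau_{\mu\nu}f\big),$$ where $$\chi^\tau_{\mu\nu}=\sum_{N\ge1}(-1)^N\frac{B_N}{N!}\Big[\sum_\alpha C^\tau_{\mu\alpha}(\mathbb C^{N-1})^\alpha_\nu-\sum_\alpha\frac{\partial(\mathbb C^{N-1})^\tau_\nu}{\partial(\partial^\alpha)}\,\mathbb C^\alpha_\mu\Big]\in\Bbbk[[\partial^1,\ldots,\partial^n]].$$
   Context: Symmetric-ordering setup: $\Bbbk$ is a field of characteristic $0$, $\mathfrak g$ an $n$-dimensional Lie algebra with basis $\hat x_1,\ldots,\hat x_n$ and $[\hat x_i,\hat x_j]=\sum_kC^k_{ij}\hat x_k$. $S(\mathfrak g)=\Bbbk[x_1,\ldots,x_n]$; $\partial^\mu$ acts on $S(\mathfrak g)$ as $\partial/\partial x_\mu$ and formal power series in the $\partial$'s act as constant-coefficient differential operators. The coexponential map $\xi:S(\mathfrak g)\to U(\mathfrak g)$ is the linear isomorphism $\xi(x_{\alpha_1}\cdots x_{\alpha_k})=\frac1{k!}\sum_{\sigma\in\Sigma_k}\hat x_{\alpha_{\sigma(1)}}\cdots\hat x_{\alpha_{\sigma(k)}}$, and $f\star g=\xi^{-1}(\xi(f)\xi(g))$. $M_\tau:=\sum_{\lambda,\rho}C^\lambda_{\tau\rho}x_\lambda\partial^\rho$,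 an operator on $S(\mathfrak g)$. $\mathbb C$ is the $n\times n$ matrix with entries $\mathbb C^\alpha_\beta=\sum_\rho C^\alpha_{\beta\rho}\partial^\rho$, $(\mathbb C^N)^\alpha_\beta$ entries of its $N$-th power (upper index = row, $\mathbb C^0$ the identity). Bernoulli numbers: $t/(e^t-1)=\sum B_Nt^N/N!$ ($B_1=-1/2$). *)

theory Defs
  imports Complex_Main "HOL-Library.Groups_Big_Fun" "HOL-Computational_Algebra.Formal_Power_Series"
begin

text \<open>Conventions. The Lie algebra has basis indexed by a finite type 'n (n = CARD('n)).
  Structure constants: C i j k stands for C^k_{ij}, i.e. [x_i,x_j] = sum_k C i j k x_k.
  Monomials are exponent vectors 'n => nat; polynomials in S(g) are functions
  ('n => nat) => 'k with finite support; formal power series in the derivations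
  are arbitrary functions ('n => nat) => 'k (coefficient of the monomial in the d's).\<close>

type_synonym 'n mono = "'n \<Rightarrow> nat"
type_synonym ('n,'k) poly = "'n mono \<Rightarrow> 'k"   (* also used for power series in the d's *)

definition Spoly :: "('n,'k::zero) poly set" where
  "Spoly = {f. finite {m. f m \<noteq> 0}}"

definition unitv :: "'n \<Rightarrow> 'n mono" where
  "unitv i = (\<lambda>j. if j = i then 1 else 0)"

definition mulx :: "'n \<Rightarrow> ('n,'k::semiring_1) poly \<Rightarrow> ('n,'k) poly" where
  "mulx l f = (\<lambda>m. if 0 < m l then f (\<lambda>j. if j = l then m j - 1 else m j) else 0)"

definition xvar :: "'n \<Rightarrow> ('n,'k::semiring_1) poly" where
  "xvar l = (\<lambda>m. if m = unitv l then 1 else 0)"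

definition pderiv :: "'n \<Rightarrow> ('n,'k::semiring_1) poly \<Rightarrow> ('n,'k) poly" where
  "pderiv r f = (\<lambda>m. of_nat (m r + 1) * f (\<lambda>j. m j + unitv r j))"

definition Mop :: "('n::finite \<Rightarrow> 'n \<Rightarrow> 'n \<Rightarrow> 'k::field_char_0) \<Rightarrow> 'n \<Rightarrow> ('n,'k) poly \<Rightarrow> ('n,'k) poly" where
  "Mop C tau f = (\<lambda>m. \<Sum>l\<in>UNIV. \<Sum>r\<in>UNIV. C tau r l * mulx l (pderiv r f) m)"

text \<open>Action of a formal power series D in the d's as constant-coefficient differential
  operator: d^a x^(m+a) = prod_i (m_i+a_i)!/m_i! x^m.\<close>
definition ps_apply :: "('n::finite,'k::field_char_0) poly \<Rightarrow> ('n,'k) poly \<Rightarrow> ('n,'k) poly" where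
  "ps_apply D f = (\<lambda>m. \<Sum>a | f (\<lambda>i. m i + a i) \<noteq> 0.
      D a * f (\<lambda>i. m i + a i) * (\<Prod>i\<in>UNIV. fact (m i + a i) / fact (m i)))"

definition ps_mult :: "('n::finite,'k::field_char_0) poly \<Rightarrow> ('n,'k) poly \<Rightarrow> ('n,'k) poly" where
  "ps_mult P Q = (\<lambda>a. \<Sum>b\<in>{b. \<forall>i. b i \<le> a i}. P b * Q (\<lambda>i. a i - b i))"

definition ps_one :: "('n,'k::field_char_0) poly" where
  "ps_one = (\<lambda>a. if a = (\<lambda>_. 0) then 1 else 0)"

definition ps_var :: "'n \<Rightarrow> ('n,'k::field_char_0) poly" where
  "ps_var r = (\<lambda>a. if a = unitv r then 1 else 0)"

definition ps_deriv :: "'n \<Rightarrow> ('n,'k::field_char_0) poly \<Rightarrow> ('n,'k) poly" where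
  "ps_deriv al P = (\<lambda>a. of_nat (a al + 1) * P (\<lambda>j. a j + unitv al j))"

text \<open>The matrix C with entries C^al_be = sum_r C^al_{be r} d^r (first index = row).\<close>
definition Cmat :: "('n::finite \<Rightarrow> 'n \<Rightarrow> 'n \<Rightarrow> 'k::field_char_0) \<Rightarrow> 'n \<Rightarrow> 'n \<Rightarrow> ('n,'k) poly" where
  "Cmat C al be = (\<lambda>a. \<Sum>r\<in>UNIV. C be r al * ps_var r a)"

fun Cpow :: "('n::finite \<Rightarrow> 'n \<Rightarrow> 'n \<Rightarrow> 'k::field_char_0) \<Rightarrow> nat \<Rightarrow> 'n \<Rightarrow> 'n \<Rightarrow> ('n,'k) poly" where
  "Cpow C 0 al be = (if al = be then ps_one else (\<lambda>_. 0))"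
| "Cpow C (Suc N) al be = (\<lambda>a. \<Sum>g\<in>UNIV. ps_mult (Cpow C N al g) (Cmat C g be) a)"

text \<open>Bernoulli numbers: t/(e^t-1) = sum B_N t^N/N!, so B_1 = -1/2.\<close>
definition bernoulli :: "nat \<Rightarrow> 'k::field_char_0" where
  "bernoulli N = fact N * fps_nth (fps_X / (fps_exp 1 - 1)) N"

text \<open>chi^tau_{mu nu}; the sum over N is a formal (coefficientwise, locally finite) sum.\<close>
definition chi :: "('n::finite \<Rightarrow> 'n \<Rightarrow> 'n \<Rightarrow> 'k::field_char_0) \<Rightarrow> 'n \<Rightarrow> 'n \<Rightarrow> 'n \<Rightarrow> ('n,'k) poly" where
  "chi C tau mu nu = (\<lambda>a. Sum_any (\<lambda>N. if 1 \<le> N then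
      (-1)^N * bernoulli N / fact N *
      ((\<Sum>al\<in>UNIV. C mu al tau * Cpow C (N - 1) al nu a)
       - (\<Sum>al\<in>UNIV. ps_mult (ps_deriv al (Cpow C (N - 1) tau nu)) (Cmat C al mu) a))
      else 0))"

text \<open>Free associative algebra on the basis: finitely supported functions on words.\<close>
definition wprod :: "('n list \<Rightarrow> 'k::field_char_0) \<Rightarrow> ('n list \<Rightarrow> 'k) \<Rightarrow> ('n list \<Rightarrow> 'k)" where
  "wprod p q = (\<lambda>w. \<Sum>i\<le>length w. p (take i w) * q (drop i w))"

definition word :: "'n list \<Rightarrow> ('n list \<Rightarrow> 'k::field_char_0)" where
  "word u = (\<lambda>w. if w = u then 1 else 0)"

definition rel :: "('n::finite \<Rightarrow> 'n \<Rightarrow> 'n \<Rightarrow> 'k::field_char_0) \<Rightarrow> 'n \<Rightarrow> 'n \<Rightarrow> ('n list \<Rightarrow> 'k)" where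
  "rel C i j = (\<lambda>w. word [i, j] w - word [j, i] w - (\<Sum>k\<in>UNIV. C i j k * word [k] w))"

text \<open>Two-sided ideal generated by the relators; U(g) = free algebra / lie_ideal.\<close>
inductive_set lie_ideal :: "('n::finite \<Rightarrow> 'n \<Rightarrow> 'n \<Rightarrow> 'k::field_char_0) \<Rightarrow> ('n list \<Rightarrow> 'k) set"
  for C where
  zero: "(\<lambda>_. 0) \<in> lie_ideal C"
| step: "p \<in> lie_ideal C \<Longrightarrow>
     (\<lambda>w. p w + c * wprod (wprod (word u) (rel C i j)) (word v) w) \<in> lie_ideal C"

text \<open>Coexponential (symmetrization) map xi: S(g) -> free algebra (then to U(g)).
  xi(x^a) = (1/k!) sum over sigma of words; the word w with multiset a occurs
  prod_i a_i! times.\<close>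
definition wmono :: "'n list \<Rightarrow> 'n mono" where
  "wmono w = (\<lambda>i. count_list w i)"

definition xi :: "('n::finite,'k::field_char_0) poly \<Rightarrow> ('n list \<Rightarrow> 'k)" where
  "xi f = (\<lambda>w. f (wmono w) * (\<Prod>i\<in>UNIV. fact (count_list w i)) / fact (length w))"

text \<open>Star product f * g = xi^{-1}(xi f xi g), computed in U(g).\<close>
definition star :: "('n::finite \<Rightarrow> 'n \<Rightarrow> 'n \<Rightarrow> 'k::field_char_0) \<Rightarrow> ('n,'k) poly \<Rightarrow> ('n,'k) poly \<Rightarrow> ('n,'k) poly" where
  "star C f g = (THE h. h \<in> Spoly \<and>
      (\<lambda>w. wprod (xi f) (xi g) w - xi h w) \<in> lie_ideal C)"

definition lie_structure :: "('n::finite \<Rightarrow> 'n \<Rightarrow> 'n \<Rightarrow> 'k::field_char_0) \<Rightarrow> bool" where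
  "lie_structure C \<longleftrightarrow>
     (\<forall>i k. C i i k = 0) \<and> (\<forall>i j k. C i j k = - C j i k) \<and>
     (\<forall>i j k l. (\<Sum>m\<in>UNIV. C i j m * C m k l + C j k m * C m i l + C k i m * C m j l) = 0)"

end

theory Submission
  imports Defs "HOL-Library.Function_Algebras"
begin

text \<open>
  Polynomials are paired with power series in the dual variables \<open>p\<close>, so that \<open>x\<^sub>l\<close> is
  transposed to \<open>\<partial>/\<partial>p\<^sub>l\<close>, \<open>\<partial>\<^sup>r\<close> to multiplication by \<open>p\<^sub>r\<close> and \<open>M\<^sub>\<mu>\<close> to a linear
  vector field.
  Writing \<open>\<phi>\<close> for the matrix \<open>\<Sum>\<^sub>N (-1)\<^sup>N B\<^sub>N/N! C\<^sup>N\<close>, the vector fields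
  \<open>V\<^sub>\<nu> = \<Sum>\<^sub>\<alpha> \<phi>\<^sup>\<alpha>\<^sub>\<nu> \<partial>/\<partial>p\<^sub>\<alpha>\<close> are dual to the one-forms given by
  \<open>\<phi>\<^sup>-\<^sup>1\<close>, the Maurer-Cartan form in exponential coordinates; its structure equation says that the
  \<open>V\<^sub>\<nu>\<close> represent the Lie algebra. Applying words of vector fields to a series and
  evaluating at \<open>0\<close> therefore factors through \<open>U(g)\<close>, and Euler's identity
  \<open>\<Sum>\<^sub>i p\<^sub>i V\<^sub>i = \<Sum>\<^sub>i p\<^sub>i \<partial>/\<partial>p\<^sub>i\<close> shows that it inverts symmetrization. Hence
  symmetrization is injective, and multiplication by \<open>x\<^sub>\<nu>\<close> in the star product is the transpose of
  \<open>V\<^sub>\<nu>\<close>. The claim becomes the computation of the commutator of \<open>V\<^sub>\<nu>\<close> with the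
  transpose of \<open>M\<^sub>\<mu>\<close>, where the derivation \<open>M\<^sub>\<mu>\<close> acts on powers of \<open>C\<close> as the commutator
  with the matrix of \<open>ad x\<^sub>\<mu>\<close>, by the Jacobi identity.
\<close>

section \<open>Monomials and formal power series\<close>

definition mfact :: "('n::finite \<Rightarrow> nat) \<Rightarrow> 'k::field_char_0" where
  "mfact m = (\<Prod>i\<in>UNIV. fact (m i))"

definition mdeg :: "('n::finite \<Rightarrow> nat) \<Rightarrow> nat" where
  "mdeg m = (\<Sum>i\<in>UNIV. m i)"

lemma finite_below: "finite {..(a :: 'n::finite \<Rightarrow> nat)}"
proof -
  have "{..a} = Pi\<^sub>E UNIV (\<lambda>i. {..a i})"
    by (auto simp: le_fun_def PiE_def Pi_def)
  then show ?thesis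
    by (simp add: finite_PiE)
qed

lemma mdeg_add [simp]: "mdeg (a + b) = mdeg a + mdeg b"
  by (simp add: mdeg_def sum.distrib)

lemma mdeg_unitv [simp]: "mdeg (unitv i) = 1"
  by (simp add: mdeg_def unitv_def)

lemma mdeg_0 [simp]: "mdeg 0 = 0"
  by (simp add: mdeg_def)

lemma mdeg_mono: "a \<le> b \<Longrightarrow> mdeg a \<le> mdeg b"
  by (simp add: mdeg_def le_fun_def sum_mono)

lemma mdeg_eq_0 [simp]: "mdeg a = 0 \<longleftrightarrow> a = 0"
  by (auto simp: mdeg_def fun_eq_iff)

lemma le_add_diff: "b \<le> a \<Longrightarrow> b + (a - b) = (a :: 'n \<Rightarrow> nat)"
  by (auto simp: fun_eq_iff le_fun_def)

lemma diff_diff_fun: "b \<le> a \<Longrightarrow> a - (a - b) = (b :: 'n \<Rightarrow> nat)"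
  by (auto simp: fun_eq_iff le_fun_def)

lemma diff_diff_add_fun: "a - b - c = a - (b + c)" for a :: "'n \<Rightarrow> nat"
  by (simp add: fun_eq_iff)

lemma mdeg_diff: "b \<le> a \<Longrightarrow> mdeg (a - b) = mdeg a - mdeg b"
  by (metis add_diff_cancel_left' mdeg_add le_add_diff)

lemma unitv_le_iff [simp]: "unitv i \<le> a \<longleftrightarrow> 0 < a i"
  by (auto simp: unitv_def le_fun_def Suc_le_eq)

lemma mfact_nz [simp]: "mfact m \<noteq> (0 :: 'k::field_char_0)"
  by (simp add: mfact_def)

lemma mfact_add_unitv: "mfact (m + unitv l) = (of_nat (m l + 1) * mfact m :: 'k::field_char_0)"
proof -
  have "(\<Prod>i\<in>UNIV - {l}. fact ((m + unitv l) i)) = (\<Prod>i\<in>UNIV - {l}. fact (m i) :: 'k)"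
    by (intro prod.cong) (auto simp: unitv_def)
  then show ?thesis
    unfolding mfact_def
    by (subst (1 2) prod.remove[of _ l]) (auto simp: unitv_def)
qed

text \<open>A type of its own, because \<open>*\<close> on plain functions is the pointwise product,
  whereas the ring structure wanted here is that of the Cauchy product.\<close>

typedef (overloaded) ('n, 'k) mps = "UNIV :: (('n \<Rightarrow> nat) \<Rightarrow> 'k) set"
  morphisms coef Mps ..

setup_lifting type_definition_mps

lemma mps_eq_iff: "P = Q \<longleftrightarrow> (\<forall>a. coef P a = coef Q a)"
  by (simp add: coef_inject[symmetric] fun_eq_iff)

lemma coef_Mps [simp]: "coef (Mps f) = f"
  by (simp add: Mps_inverse)

lemma ps_mult_conv: "ps_mult P Q a = (\<Sum>b\<in>{..a}. P b * Q (a - b))"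
  by (auto simp: ps_mult_def atMost_def le_fun_def fun_diff_def)

instantiation mps :: (finite, field_char_0) comm_ring_1
begin
lift_definition zero_mps :: "('a, 'b) mps" is "\<lambda>_. 0" .
lift_definition one_mps :: "('a, 'b) mps" is ps_one .
lift_definition plus_mps :: "('a, 'b) mps \<Rightarrow> ('a, 'b) mps \<Rightarrow> ('a, 'b) mps" is "\<lambda>f g a. f a + g a" .
lift_definition minus_mps :: "('a, 'b) mps \<Rightarrow> ('a, 'b) mps \<Rightarrow> ('a, 'b) mps" is "\<lambda>f g a. f a - g a" .
lift_definition uminus_mps :: "('a, 'b) mps \<Rightarrow> ('a, 'b) mps" is "\<lambda>f a. - f a" .
lift_definition times_mps :: "('a, 'b) mps \<Rightarrow> ('a, 'b) mps \<Rightarrow> ('a, 'b) mps" is ps_mult .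

instance
proof
  fix P Q R :: "('a, 'b) mps"
  show "P + Q + R = P + (Q + R)" "P + Q = Q + P" "0 + P = P" "- P + P = 0" "P - Q = P + - Q"
    by (transfer; simp add: fun_eq_iff algebra_simps)+
  show "(0::('a, 'b) mps) \<noteq> 1"
    by transfer (auto simp: ps_one_def fun_eq_iff)
  show "(P + Q) * R = P * R + Q * R"
    by transfer (simp add: fun_eq_iff ps_mult_conv algebra_simps sum.distrib)
  show "P * Q = Q * P"
  proof (transfer, rule ext)
    fix P Q :: "('a \<Rightarrow> nat) \<Rightarrow> 'b" and a
    show "ps_mult P Q a = ps_mult Q P a"
      unfolding ps_mult_conv
      by (rule sum.reindex_bij_witness[of _ "\<lambda>b. a - b" "\<lambda>b. a - b"])
         (auto simp: diff_diff_fun mult.commute le_funI)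
  qed
  show "1 * P = P"
  proof (transfer, rule ext)
    fix P :: "('a \<Rightarrow> nat) \<Rightarrow> 'b" and a
    have "ps_mult ps_one P a = (\<Sum>b\<in>{..a}. if b = 0 then P (a - b) else 0)"
      unfolding ps_mult_conv by (intro sum.cong) (auto simp: ps_one_def zero_fun_def)
    also have "\<dots> = P a"
      by (simp add: finite_below le_fun_def fun_diff_def)
    finally show "ps_mult ps_one P a = P a" .
  qed
  show "P * Q * R = P * (Q * R)"
  proof (transfer, rule ext)
    fix P Q R :: "('a \<Rightarrow> nat) \<Rightarrow> 'b" and a
    have "ps_mult (ps_mult P Q) R a
        = (\<Sum>(b, c)\<in>(SIGMA b:{..a}. {..b}). P c * Q (b - c) * R (a - b))"
      unfolding ps_mult_conv
      by (simp add: sum.Sigma finite_below sum_distrib_right)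
    \<comment> \<open>Both double sums run over the decompositions of \<open>a\<close> into three
      exponents.\<close>
    also have "\<dots> = (\<Sum>(c, e)\<in>(SIGMA c:{..a}. {..a - c}). P c * (Q e * R (a - c - e)))"
      by (rule sum.reindex_bij_witness[of _ "\<lambda>(c, e). (c + e, c)" "\<lambda>(b, c). (c, b - c)"])
         (auto simp: le_add_diff mult.assoc diff_diff_add_fun le_fun_def le_diff_conv2 add.commute diff_le_mono
           intro: order.trans)
    also have "\<dots> = ps_mult P (ps_mult Q R) a"
      unfolding ps_mult_conv
      by (simp add: sum.Sigma finite_below sum_distrib_left)
    finally show "ps_mult (ps_mult P Q) R a = ps_mult P (ps_mult Q R) a" .
  qed
qed
end

lemma coef_zero [simp]: "coef 0 a = 0"
  by (simp add: zero_mps.rep_eq)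
lemma coef_one: "coef 1 a = (if a = 0 then 1 else 0)"
  by (simp add: one_mps.rep_eq ps_one_def zero_fun_def)
lemma coef_add [simp]: "coef (P + Q) a = coef P a + coef Q a"
  by (simp add: plus_mps.rep_eq)
lemma coef_diff [simp]: "coef (P - Q) a = coef P a - coef Q a"
  by (simp add: minus_mps.rep_eq)
lemma coef_uminus [simp]: "coef (- P) a = - coef P a"
  by (simp add: uminus_mps.rep_eq)
lemma coef_mult: "coef (P * Q) a = (\<Sum>b\<in>{..a}. coef P b * coef Q (a - b))"
  by (simp add: times_mps.rep_eq ps_mult_conv)
lemma coef_sum [simp]: "coef (sum P A) a = (\<Sum>x\<in>A. coef (P x) a)"
  by (induction A rule: infinite_finite_induct) auto

section \<open>Constants, variables and partial derivatives of power series\<close>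

definition mconst :: "'k::field_char_0 \<Rightarrow> ('n::finite, 'k) mps" where
  "mconst c = Mps (\<lambda>a. if a = 0 then c else 0)"

lemma coef_mconst: "coef (mconst c) a = (if a = 0 then c else 0)"
  by (simp add: mconst_def)

lemma coef_mconst_mult [simp]: "coef (mconst c * P) a = c * coef P a"
proof -
  have "coef (mconst c * P) a = (\<Sum>b\<in>{..a}. if b = 0 then c * coef P a else 0)"
    unfolding coef_mult by (intro sum.cong) (auto simp: coef_mconst fun_diff_def)
  also have "\<dots> = c * coef P a"
    by (simp add: finite_below le_fun_def)
  finally show ?thesis .
qed

lemma coef_mult_mconst [simp]: "coef (P * mconst c) a = c * coef P a"
  by (subst mult.commute) simp

lemma mconst_simps [simp]: "mconst 0 = 0" "mconst 1 = 1"
  by (auto simp: mps_eq_iff coef_mconst coef_one)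

lemma mconst_add: "mconst (c + d) = mconst c + mconst d"
  by (simp add: mps_eq_iff coef_mconst)
lemma mconst_uminus: "mconst (- c) = - mconst c"
  by (simp add: mps_eq_iff coef_mconst)
lemma mconst_mult: "mconst (c * d) = mconst c * mconst d"
  by (auto simp: mps_eq_iff coef_mconst)
lemma mconst_sum: "mconst (sum c A) = (\<Sum>x\<in>A. mconst (c x))"
  by (induction A rule: infinite_finite_induct) (auto simp: mconst_add)

definition mvar :: "'n::finite \<Rightarrow> ('n, 'k::field_char_0) mps" where
  "mvar r = Mps (ps_var r)"

lemma coef_mvar: "coef (mvar r) a = (if a = unitv r then 1 else 0)"
  by (simp add: mvar_def ps_var_def)

lemma coef_mvar_mult: "coef (mvar r * P) a = (if 0 < a r then coef P (a - unitv r) else 0)"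
proof -
  have "coef (mvar r * P) a = (\<Sum>b\<in>{..a}. if b = unitv r then coef P (a - unitv r) else 0)"
    unfolding coef_mult by (intro sum.cong) (auto simp: coef_mvar)
  also have "\<dots> = (if unitv r \<le> a then coef P (a - unitv r) else 0)"
    by (simp add: finite_below)
  finally show ?thesis by simp
qed

definition mderiv :: "'n::finite \<Rightarrow> ('n, 'k::field_char_0) mps \<Rightarrow> ('n, 'k) mps" where
  "mderiv l P = Mps (ps_deriv l (coef P))"

lemma coef_mderiv: "coef (mderiv l P) a = of_nat (a l + 1) * coef P (a + unitv l)"
  by (simp add: mderiv_def ps_deriv_def plus_fun_def)

lemma mderiv_add [simp]: "mderiv l (P + Q) = mderiv l P + mderiv l Q"
  and mderiv_diff [simp]: "mderiv l (P - Q) = mderiv l P - mderiv l Q"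
  and mderiv_zero [simp]: "mderiv l 0 = 0"
  by (simp_all add: mps_eq_iff coef_mderiv algebra_simps)

lemma mderiv_sum [simp]: "mderiv l (sum P A) = (\<Sum>x\<in>A. mderiv l (P x))"
  by (induction A rule: infinite_finite_induct) auto

lemma mderiv_mconst [simp]: "mderiv l (mconst c) = 0"
proof -
  have "a + unitv l \<noteq> 0" for a :: "'a \<Rightarrow> nat"
    by (metis mdeg_0 mdeg_add mdeg_unitv add_is_0 one_neq_zero)
  then show ?thesis by (simp add: mps_eq_iff coef_mderiv coef_mconst)
qed

lemma mderiv_one [simp]: "mderiv l 1 = 0"
  using mderiv_mconst[of l 1] by simp

lemma mderiv_mvar: "mderiv l (mvar r) = (if l = r then 1 else 0)"
proof -
  have "(a + unitv l = unitv r) \<longleftrightarrow> (l = r \<and> a = 0)" for a :: "'a \<Rightarrow> nat"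
  proof
    assume *: "a + unitv l = unitv r"
    have "mdeg (a + unitv l) = 1" unfolding * by simp
    then have "a = 0" by simp
    with * have "unitv l l = unitv r l" by simp
    with \<open>a = 0\<close> show "l = r \<and> a = 0" by (auto simp: unitv_def split: if_splits)
  qed auto
  then show ?thesis by (auto simp: mps_eq_iff coef_mderiv coef_mvar coef_one)
qed

lemma mderiv_commute: "mderiv l (mderiv r P) = mderiv r (mderiv l P)"
  by (auto simp: mps_eq_iff coef_mderiv unitv_def add_ac)

text \<open>The factor \<open>a l + 1\<close> produced by differentiation is split over each
  decomposition of \<open>a + unitv l\<close> into \<open>b\<close> and its complement: the share
  \<open>b l\<close> belongs to the derivative of \<open>P\<close>, the share
  \<open>a l + 1 - b l\<close> to that of \<open>Q\<close>.\<close>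

lemma mderiv_mult [simp]: "mderiv l (P * Q) = mderiv l P * Q + P * mderiv l Q"
proof -
  have "coef (mderiv l (P * Q)) a = coef (mderiv l P * Q + P * mderiv l Q) a" for a
  proof -
    let ?e = "unitv l :: 'a \<Rightarrow> nat"
    let ?f = "\<lambda>b. coef P b * coef Q (a + ?e - b)"
    have "coef (mderiv l (P * Q)) a = (\<Sum>b\<in>{..a + ?e}. of_nat (a l + 1) * ?f b)"
      by (simp add: coef_mderiv coef_mult sum_distrib_left)
    also have "\<dots> = (\<Sum>b\<in>{..a + ?e}. of_nat (b l) * ?f b + of_nat (a l + 1 - b l) * ?f b)"
    proof (intro sum.cong refl)
      fix b assume "b \<in> {..a + ?e}"
      then have "b l \<le> a l + 1" by (auto simp: le_fun_def unitv_def dest: spec[of _ l])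
      then have "of_nat (a l + 1) = (of_nat (b l) + of_nat (a l + 1 - b l) :: 'b)"
        by (metis le_add_diff_inverse of_nat_add)
      then show "of_nat (a l + 1) * ?f b = of_nat (b l) * ?f b + of_nat (a l + 1 - b l) * ?f b"
        by (simp add: algebra_simps)
    qed
    also have "\<dots> = (\<Sum>b\<in>{..a + ?e}. of_nat (b l) * ?f b) + (\<Sum>b\<in>{..a + ?e}. of_nat (a l + 1 - b l) * ?f b)"
      by (simp add: sum.distrib)
    also have "(\<Sum>b\<in>{..a + ?e}. of_nat (b l) * ?f b) = (\<Sum>b\<in>{b\<in>{..a + ?e}. 0 < b l}. of_nat (b l) * ?f b)"
      by (rule sum.mono_neutral_right) (auto simp: finite_below)
    also have "\<dots> = (\<Sum>b\<in>{..a}. of_nat (b l + 1) * coef P (b + ?e) * coef Q (a - b))"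
      by (rule sum.reindex_bij_witness[of _ "\<lambda>b. b + ?e" "\<lambda>b. b - ?e"])
         (auto simp: le_fun_def fun_eq_iff unitv_def fun_diff_def plus_fun_def Suc_diff_le algebra_simps
             intro!: arg_cong[of _ _ "coef P"] arg_cong[of _ _ "coef Q"] split: if_splits)
    also have "\<dots> = coef (mderiv l P * Q) a"
      by (simp add: coef_mult coef_mderiv)
    \<comment> \<open>An exponent \<open>b\<close> below \<open>a + unitv l\<close> but not below
      \<open>a\<close> has \<open>b l = a l + 1\<close>, so its weight vanishes.\<close>
    also have "(\<Sum>b\<in>{..a + ?e}. of_nat (a l + 1 - b l) * ?f b) = (\<Sum>b\<in>{..a}. of_nat (a l + 1 - b l) * ?f b)"
    proof (rule sum.mono_neutral_right)
      show "\<forall>b\<in>{..a + ?e} - {..a}. of_nat (a l + 1 - b l) * ?f b = 0"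
      proof
        fix b assume "b \<in> {..a + ?e} - {..a}"
        then have b: "\<And>i. b i \<le> a i + ?e i" "\<exists>i. \<not> b i \<le> a i"
          by (auto simp: le_fun_def)
        then obtain i where i: "\<not> b i \<le> a i" by blast
        with b(1)[of i] have "i = l" by (auto simp: unitv_def split: if_splits)
        with i show "of_nat (a l + 1 - b l) * ?f b = 0" by simp
      qed
    qed (auto simp: finite_below le_fun_def intro: le_SucI trans_le_add1)
    also have "\<dots> = coef (P * mderiv l Q) a"
    proof -
      have "of_nat (a l + 1 - b l) * ?f b = coef P b * (of_nat ((a - b) l + 1) * coef Q (a - b + ?e))" if "b \<le> a" for b
      proof -
        have "a + ?e - b = a - b + ?e" using that by (auto simp: le_fun_def fun_eq_iff)
        moreover have "a l + 1 - b l = (a - b) l + 1" using that by (auto simp: le_fun_def Suc_diff_le)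
        ultimately show ?thesis by (simp add: algebra_simps)
      qed
      then show ?thesis unfolding coef_mult coef_mderiv by (intro sum.cong) auto
    qed
    finally show ?thesis by simp
  qed
  then show ?thesis by (simp add: mps_eq_iff)
qed

text \<open>The degree operator E. Since it acts as the scalar n in degree n, an equation for E + c
  becomes a recursion on the degree.\<close>

definition euler :: "('n::finite, 'k::field_char_0) mps \<Rightarrow> ('n, 'k) mps" where
  "euler P = (\<Sum>r\<in>UNIV. mvar r * mderiv r P)"

lemma coef_euler: "coef (euler P) a = of_nat (mdeg a) * coef P a"
proof -
  have "coef (euler P) a = (\<Sum>r\<in>UNIV. of_nat (a r) * coef P a)"
    unfolding euler_def coef_sum
  proof (intro sum.cong refl)
    fix r
    have "a - unitv r + unitv r = a" if "0 < a r"
      using that by (auto simp: fun_eq_iff unitv_def)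
    then show "coef (mvar r * mderiv r P) a = of_nat (a r) * coef P a"
      by (auto simp: coef_mvar_mult coef_mderiv unitv_def)
  qed
  then show ?thesis by (simp add: mdeg_def sum_distrib_right)
qed

section \<open>The matrix of structure constants\<close>

definition Cmps :: "('n::finite \<Rightarrow> 'n \<Rightarrow> 'n \<Rightarrow> 'k::field_char_0) \<Rightarrow> 'n \<Rightarrow> 'n \<Rightarrow> ('n, 'k) mps" where
  "Cmps C al be = (\<Sum>r\<in>UNIV. mconst (C be r al) * mvar r)"

definition Cmpow :: "('n::finite \<Rightarrow> 'n \<Rightarrow> 'n \<Rightarrow> 'k::field_char_0) \<Rightarrow> nat \<Rightarrow> 'n \<Rightarrow> 'n \<Rightarrow> ('n, 'k) mps" where
  "Cmpow C N al be = Mps (Cpow C N al be)"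

lemma Mps_Cmat: "Mps (Cmat C al be) = Cmps C al be"
  by (simp add: mps_eq_iff Cmat_def Cmps_def coef_mvar ps_var_def)

lemma Cmpow_0: "Cmpow C 0 al be = (if al = be then 1 else 0)"
  by (auto simp: mps_eq_iff Cmpow_def one_mps.rep_eq)

lemma Cmpow_Suc: "Cmpow C (Suc N) al be = (\<Sum>g\<in>UNIV. Cmpow C N al g * Cmps C g be)"
  by (simp add: mps_eq_iff Cmpow_def times_mps.rep_eq flip: Mps_Cmat)

lemma Cmpow_add: "Cmpow C (M + N) al be = (\<Sum>g\<in>UNIV. Cmpow C M al g * Cmpow C N g be)"
proof (induction N arbitrary: be)
  case 0
  show ?case by (simp add: Cmpow_0 if_distrib cong: if_cong)
next
  case (Suc N)
  have "Cmpow C (M + Suc N) al be = (\<Sum>h\<in>UNIV. \<Sum>g\<in>UNIV. Cmpow C M al g * Cmpow C N g h * Cmps C h be)"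
    by (simp add: Cmpow_Suc Suc sum_distrib_right)
  also have "\<dots> = (\<Sum>g\<in>UNIV. \<Sum>h\<in>UNIV. Cmpow C M al g * Cmpow C N g h * Cmps C h be)"
    by (rule sum.swap)
  finally show ?case
    by (simp add: Cmpow_Suc sum_distrib_left mult.assoc)
qed

lemma Cmpow_1: "Cmpow C (Suc 0) al be = Cmps C al be"
proof -
  have "Cmpow C (Suc 0) al be = (\<Sum>g\<in>UNIV. if al = g then Cmps C g be else 0)"
    unfolding Cmpow_Suc by (intro sum.cong) (auto simp: Cmpow_0)
  then show ?thesis by simp
qed

section \<open>Homogeneous entries and power series in the matrix\<close>

definition homog :: "nat \<Rightarrow> ('n::finite, 'k::field_char_0) mps \<Rightarrow> bool" where
  "homog n P \<longleftrightarrow> (\<forall>a. coef P a \<noteq> 0 \<longrightarrow> mdeg a = n)"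

lemma homog_mult:
  assumes "homog m P" "homog n Q"
  shows "homog (m + n) (P * Q)"
  unfolding homog_def
proof (intro allI impI)
  fix a assume "coef (P * Q) a \<noteq> 0"
  then obtain b where "b \<le> a" "coef P b * coef Q (a - b) \<noteq> 0"
    unfolding coef_mult by (meson atMost_iff sum.not_neutral_contains_not_neutral)
  then show "mdeg a = m + n"
    using assms mdeg_add[of b "a - b"] by (auto simp: homog_def le_add_diff)
qed

lemma homog_sum: "(\<And>x. x \<in> A \<Longrightarrow> homog n (P x)) \<Longrightarrow> homog n (sum P A)"
  unfolding homog_def coef_sum by (meson sum.not_neutral_contains_not_neutral)

lemma homog_Cmps: "homog 1 (Cmps C al be)"
  unfolding Cmps_def by (intro homog_sum) (auto simp: homog_def coef_mvar)

lemma homog_Cmpow: "homog N (Cmpow C N al be)"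
proof (induction N arbitrary: be)
  case 0
  show ?case by (auto simp: Cmpow_0 homog_def coef_one)
next
  case (Suc N)
  show ?case unfolding Cmpow_Suc
    using homog_mult[OF Suc homog_Cmps] by (intro homog_sum) auto
qed

text \<open>The matrix \<open>F(C)\<close>: the entries of \<open>C\<^sup>N\<close> are homogeneous of degree \<open>N\<close>, so only
  \<open>N = mdeg a\<close> contributes to the coefficient of \<open>a\<close>.\<close>

definition Ceval :: "('n::finite \<Rightarrow> 'n \<Rightarrow> 'n \<Rightarrow> 'k::field_char_0) \<Rightarrow> 'k fps \<Rightarrow> 'n \<Rightarrow> 'n \<Rightarrow> ('n, 'k) mps" where
  "Ceval C F al be = Mps (\<lambda>a. fps_nth F (mdeg a) * coef (Cmpow C (mdeg a) al be) a)"

lemma coef_Ceval: "coef (Ceval C F al be) a = fps_nth F (mdeg a) * coef (Cmpow C (mdeg a) al be) a"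
  by (simp add: Ceval_def)

lemma Ceval_add: "Ceval C (F + G) al be = Ceval C F al be + Ceval C G al be"
  and Ceval_diff: "Ceval C (F - G) al be = Ceval C F al be - Ceval C G al be"
  by (simp_all add: mps_eq_iff coef_Ceval algebra_simps)

lemma Ceval_1: "Ceval C 1 al be = (if al = be then 1 else 0)"
  by (auto simp: mps_eq_iff coef_Ceval coef_one Cmpow_0)

lemma Ceval_X: "Ceval C fps_X al be = Cmps C al be"
  using homog_Cmps[of C al be]
  by (auto simp: mps_eq_iff coef_Ceval homog_def fps_X_def Cmpow_1)

text \<open>Powers of a single matrix multiply by adding exponents. By homogeneity, the
  decomposition of \<open>a\<close> into \<open>b\<close> and \<open>a - b\<close> receives only the
  term \<open>i = mdeg b\<close> of the Cauchy product of the two series.\<close>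

lemma Ceval_mult: "Ceval C (F * G) al be = (\<Sum>g\<in>UNIV. Ceval C F al g * Ceval C G g be)"
proof -
  have "coef (Ceval C (F * G) al be) a = coef (\<Sum>g\<in>UNIV. Ceval C F al g * Ceval C G g be) a" for a
  proof -
    let ?n = "mdeg a"
    let ?c = "\<lambda>i g b. coef (Cmpow C i al g) b * coef (Cmpow C (?n - i) g be) (a - b)"
    have "coef (Ceval C (F * G) al be) a
      = (\<Sum>i\<in>{..?n}. fps_nth F i * fps_nth G (?n - i) * coef (Cmpow C (i + (?n - i)) al be) a)"
      by (simp add: coef_Ceval fps_mult_nth sum_distrib_right atMost_atLeast0)
    also have "\<dots> = (\<Sum>i\<in>{..?n}. \<Sum>g\<in>UNIV. \<Sum>b\<in>{..a}. fps_nth F i * fps_nth G (?n - i) * ?c i g b)"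
      unfolding Cmpow_add coef_sum coef_mult sum_distrib_left ..
    also have "\<dots> = (\<Sum>g\<in>UNIV. \<Sum>i\<in>{..?n}. \<Sum>b\<in>{..a}. fps_nth F i * fps_nth G (?n - i) * ?c i g b)"
      by (rule sum.swap)
    also have "\<dots> = (\<Sum>g\<in>UNIV. \<Sum>b\<in>{..a}. \<Sum>i\<in>{..?n}. fps_nth F i * fps_nth G (?n - i) * ?c i g b)"
      by (rule sum.cong[OF refl], rule sum.swap)
    also have "\<dots> = (\<Sum>g\<in>UNIV. \<Sum>b\<in>{..a}. fps_nth F (mdeg b) * fps_nth G (?n - mdeg b) * ?c (mdeg b) g b)"
    proof (intro sum.cong refl)
      fix g b assume "b \<in> {..a}"
      then have "mdeg b \<le> ?n" by (simp add: mdeg_mono)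
      have "(\<Sum>i\<in>{..?n}. fps_nth F i * fps_nth G (?n - i) * ?c i g b)
          = (\<Sum>i\<in>{mdeg b}. fps_nth F i * fps_nth G (?n - i) * ?c i g b)"
        using \<open>mdeg b \<le> ?n\<close> homog_Cmpow[of _ C al g]
        by (intro sum.mono_neutral_right) (auto simp: homog_def)
      then show "(\<Sum>i\<in>{..?n}. fps_nth F i * fps_nth G (?n - i) * ?c i g b)
          = fps_nth F (mdeg b) * fps_nth G (?n - mdeg b) * ?c (mdeg b) g b" by simp
    qed
    also have "\<dots> = coef (\<Sum>g\<in>UNIV. Ceval C F al g * Ceval C G g be) a"
      by (simp add: coef_mult coef_Ceval mdeg_diff mult_ac)
    finally show ?thesis .
  qed
  then show ?thesis by (simp add: mps_eq_iff)
qed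

text \<open>In degree n both E and t d/dt multiply by n.\<close>

lemma euler_Ceval: "euler (Ceval C F al be) = Ceval C (fps_X * fps_deriv F) al be"
proof -
  have "of_nat n * fps_nth F n = fps_nth (fps_X * fps_deriv F) n" for n
    by (cases n) auto
  then show ?thesis by (simp add: mps_eq_iff coef_euler coef_Ceval mult.assoc[symmetric])
qed

section \<open>The Maurer-Cartan equation\<close>

lemma euler_add [simp]: "euler (P + Q) = euler P + euler Q"
  and euler_diff [simp]: "euler (P - Q) = euler P - euler Q"
  and euler_zero [simp]: "euler 0 = 0"
  by (simp_all add: mps_eq_iff coef_euler algebra_simps)

lemma euler_mconst [simp]: "euler (mconst c) = 0"
  by (simp add: euler_def)

lemma euler_sum [simp]: "euler (sum P A) = (\<Sum>x\<in>A. euler (P x))"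
  by (induction A rule: infinite_finite_induct) auto

lemma euler_mult: "euler (P * Q) = euler P * Q + P * euler Q"
  by (simp add: euler_def sum_distrib_left sum_distrib_right sum.distrib algebra_simps)

lemma euler_mderiv: "euler (mderiv l P) = mderiv l (euler P) - mderiv l P"
proof -
  have "mderiv l (euler P) = (\<Sum>r\<in>UNIV. (if l = r then mderiv r P else 0) + mvar r * mderiv r (mderiv l P))"
    unfolding euler_def mderiv_sum by (intro sum.cong) (auto simp: mderiv_mvar mderiv_commute[of l])
  also have "\<dots> = mderiv l P + euler (mderiv l P)"
    by (simp add: sum.distrib euler_def)
  finally show ?thesis by simp
qed

lemma mderiv_Cmps: "mderiv l (Cmps C al be) = mconst (C be l al)"
proof -
  have "mderiv l (Cmps C al be) = (\<Sum>r\<in>UNIV. if l = r then mconst (C be r al) else 0)"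
    unfolding Cmps_def mderiv_sum by (intro sum.cong) (auto simp: mderiv_mvar)
  then show ?thesis by simp
qed

section \<open>The Lie algebra axioms in matrix form and the Bernoulli series\<close>

lemma lie_antisym: "lie_structure C \<Longrightarrow> C i j k = - C j i k"
  unfolding lie_structure_def by blast

lemma lie_jacobi:
  "lie_structure C \<Longrightarrow>
   (\<Sum>m\<in>UNIV. C i j m * C m k l + C j k m * C m i l + C k i m * C m j l) = 0"
  unfolding lie_structure_def by blast

text \<open>For the generic element p, the sum of the \<open>mvar r\<close> times the basis vectors,
  \<open>Cmps C\<close> is the matrix of v -> [v, p]. The Jacobi identity says that this map is a
  derivation of the bracket.\<close>

lemma jacobi_Cmps:
  assumes "lie_structure C"
  shows "(\<Sum>m\<in>UNIV. mconst (C m j al) * Cmps C m i + mconst (C i m al) * Cmps C m j)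
       = (\<Sum>m\<in>UNIV. mconst (C i j m) * Cmps C al m)"
proof -
  have J: "(\<Sum>m\<in>UNIV. C i r m * C m j al + C j r m * C i m al) = (\<Sum>m\<in>UNIV. C i j m * C m r al)" for r
  proof -
    have "(\<Sum>m\<in>UNIV. C i j m * C m r al) - (\<Sum>m\<in>UNIV. C i r m * C m j al + C j r m * C i m al)
      = (\<Sum>m\<in>UNIV. C i j m * C m r al + C j r m * C m i al + C r i m * C m j al)"
      unfolding sum_subtractf[symmetric]
      by (intro sum.cong refl, subst (2) lie_antisym[OF assms], subst (7) lie_antisym[OF assms])
         (simp add: algebra_simps)
    then show ?thesis using lie_jacobi[OF assms, of i j r al] by simp
  qed
  have "(\<Sum>m\<in>UNIV. mconst (C m j al) * Cmps C m i + mconst (C i m al) * Cmps C m j)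
      = (\<Sum>m\<in>UNIV. \<Sum>r\<in>UNIV. mconst (C i r m * C m j al + C j r m * C i m al) * mvar r)"
    by (simp add: Cmps_def sum_distrib_left sum.distrib mconst_add mconst_mult algebra_simps)
  also have "\<dots> = (\<Sum>r\<in>UNIV. mconst (\<Sum>m\<in>UNIV. C i r m * C m j al + C j r m * C i m al) * mvar r)"
    by (subst sum.swap) (simp add: mconst_sum sum_distrib_right)
  also have "\<dots> = (\<Sum>r\<in>UNIV. mconst (\<Sum>m\<in>UNIV. C i j m * C m r al) * mvar r)"
    unfolding J ..
  also have "\<dots> = (\<Sum>m\<in>UNIV. \<Sum>r\<in>UNIV. mconst (C i j m * C m r al) * mvar r)"
    by (subst sum.swap) (simp add: mconst_sum sum_distrib_right)
  also have "\<dots> = (\<Sum>m\<in>UNIV. mconst (C i j m) * Cmps C al m)"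
    by (simp add: Cmps_def sum_distrib_left mconst_mult mult.assoc)
  finally show ?thesis .
qed

text \<open>The expansion of t/(1 - e^(-t)), that is, of t/(e^t - 1) at -t.\<close>

definition bern_fps :: "'k::field_char_0 fps" where
  "bern_fps = Abs_fps (\<lambda>N. (-1) ^ N * bernoulli N / fact N)"

text \<open>The coefficients of \<open>(1 - e\<^sup>-\<^sup>t)/t\<close>; as \<open>ad p\<close> has matrix \<open>-C\<close>, this series at \<open>C\<close> is
  \<open>(e\<^sup>a - 1)/a\<close> at \<open>a = ad p\<close>.\<close>

definition exq_fps :: "'k::field_char_0 fps" where
  "exq_fps = Abs_fps (\<lambda>N. (-1) ^ N / fact (Suc N))"

text \<open>At -t in place of t the factors are t/(e^t - 1) and (e^t - 1)/t; the sign
  \<open>(-1) ^ n\<close> distributes over the Cauchy product.\<close>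

lemma bern_exq: "bern_fps * exq_fps = (1 :: 'k::field_char_0 fps)"
proof -
  define H :: "'k fps" where "H = Abs_fps (\<lambda>N. 1 / fact (Suc N))"
  define F :: "'k fps" where "F = fps_X / (fps_exp 1 - 1)"
  have XH: "fps_exp 1 - 1 = fps_X * H"
  proof (rule fps_ext)
    fix n show "fps_nth (fps_exp 1 - 1) n = fps_nth (fps_X * H) n"
      by (cases n) (auto simp: H_def simp del: fact_Suc)
  qed
  have H0: "fps_nth H 0 \<noteq> 0" by (simp add: H_def)
  have "F = 1 / H"
  proof -
    have "F = (fps_X * 1) / (fps_X * H)" unfolding F_def XH by simp
    then show ?thesis by (metis fps_X_neq_zero fps_divide_cancel mult.commute)
  qed
  with H0 have FH: "F * H = 1"
    by (metis fps_divide_unit mult.commute mult.left_neutral inverse_mult_eq_1)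
  show ?thesis
  proof (rule fps_ext)
    fix n
    have "fps_nth (bern_fps * exq_fps :: 'k fps) n
        = (\<Sum>i=0..n. (-1) ^ n * (fps_nth F i * fps_nth H (n - i)))"
      unfolding fps_mult_nth
    proof (intro sum.cong refl)
      fix i assume "i \<in> {0..n}"
      then have "(-1) ^ n = ((-1) ^ i * (-1) ^ (n - i) :: 'k)"
        by (simp flip: power_add)
      then show "fps_nth (bern_fps :: 'k fps) i * fps_nth exq_fps (n - i)
          = (-1) ^ n * (fps_nth F i * fps_nth H (n - i))"
        by (simp add: bern_fps_def exq_fps_def bernoulli_def F_def H_def)
    qed
    also have "\<dots> = (-1) ^ n * fps_nth (F * H) n"
      by (simp add: fps_mult_nth sum_distrib_left)
    also have "\<dots> = fps_nth 1 n" unfolding FH by simp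
    finally show "fps_nth (bern_fps * exq_fps :: 'k fps) n = fps_nth 1 n" .
  qed
qed

text \<open>For h = (1 - e^(-t))/t, both sides equal e^(-t): the left one is (t h)', and t h = 1 -
  e^(-t).\<close>

lemma exq_ode: "fps_X * fps_deriv exq_fps + exq_fps = 1 - fps_X * (exq_fps :: 'k::field_char_0 fps)"
proof (rule fps_ext)
  fix n
  show "fps_nth (fps_X * fps_deriv exq_fps + exq_fps) n = fps_nth (1 - fps_X * (exq_fps :: 'k fps)) n"
  proof (cases n)
    case (Suc m)
    have "of_nat (Suc m) * (x / fact (Suc (Suc m))) + x / fact (Suc (Suc m)) = x / fact (Suc m)" for x :: 'k
    proof -
      have "of_nat (Suc m) * (x / fact (Suc (Suc m))) + x / fact (Suc (Suc m))
          = of_nat (Suc (Suc m)) * x / (of_nat (Suc (Suc m)) * fact (Suc m))"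
        by (simp add: fact_Suc[of "Suc m"] add_divide_distrib[symmetric] algebra_simps del: fact_Suc)
      also have "\<dots> = x / fact (Suc m)"
        by (subst nonzero_mult_divide_mult_cancel_left) (auto simp del: of_nat_Suc)
      finally show ?thesis .
    qed
    from this[of "(-1) ^ Suc m"] show ?thesis
      by (simp add: Suc exq_fps_def del: fact_Suc of_nat_Suc)
  qed (simp add: exq_fps_def)
qed

lemma bern_fps_0: "fps_nth bern_fps 0 = (1 :: 'k::field_char_0)"
proof -
  have "fps_nth (bern_fps * exq_fps) 0 = (1 :: 'k)" unfolding bern_exq by simp
  then show ?thesis by (simp add: exq_fps_def)
qed

text \<open>The differential equation of h evaluated at the matrix, with t d/dt turned into
  E.\<close>

lemma exq_euler:
  "euler (Ceval C exq_fps al be) + Ceval C exq_fps al be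
   = (if al = be then 1 else 0) - (\<Sum>g\<in>UNIV. Cmps C al g * Ceval C exq_fps g be)"
  unfolding euler_Ceval Ceval_add[symmetric] exq_ode
  by (simp add: Ceval_diff Ceval_1 Ceval_mult Ceval_X)

text \<open>The component along \<open>x\<^sub>\<alpha>\<close> of \<open>\<partial>\<^sub>\<beta> \<omega>\<^sub>\<gamma> - \<partial>\<^sub>\<gamma> \<omega>\<^sub>\<beta> - [\<omega>\<^sub>\<beta>, \<omega>\<^sub>\<gamma>]\<close> for the
  Maurer-Cartan form \<open>\<omega>\<close>. It vanishes because the Euler operator \<open>E\<close> satisfies
  \<open>(E + 1) \<omega>\<^sub>\<beta> = x\<^sub>\<beta> + [p, \<omega>\<^sub>\<beta>]\<close>, so that \<open>E + 2\<close> acts on it as \<open>ad p\<close>, which raises the degree.\<close>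

definition mcdefect :: "('n::finite \<Rightarrow> 'n \<Rightarrow> 'n \<Rightarrow> 'k::field_char_0) \<Rightarrow> 'n \<Rightarrow> 'n \<Rightarrow> 'n \<Rightarrow> ('n, 'k) mps" where
  "mcdefect C be ga al = mderiv be (Ceval C exq_fps al ga) - mderiv ga (Ceval C exq_fps al be)
     - (\<Sum>i\<in>UNIV. \<Sum>j\<in>UNIV. mconst (C i j al) * (Ceval C exq_fps i be * Ceval C exq_fps j ga))"

lemma mcdefect_euler:
  assumes lie: "lie_structure C"
  shows "euler (mcdefect C be ga al) + mcdefect C be ga al + mcdefect C be ga al = - (\<Sum>g\<in>UNIV. Cmps C al g * mcdefect C be ga g)"
proof -
  let ?h = "Ceval C exq_fps"
  let ?d = "\<lambda>al be. if al = be then 1 else (0 :: ('a, 'b) mps)"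
  \<comment> \<open>Differentiating the equation for E + 1 gives one for E + 2, because a partial
    derivative lowers the degree by one; the product rule adds a term in which the linear entry of C
    is differentiated.\<close>
  have T: "euler (mderiv l (?h al k)) + mderiv l (?h al k) + mderiv l (?h al k)
      = - (\<Sum>g\<in>UNIV. mconst (C g l al) * ?h g k) - (\<Sum>g\<in>UNIV. Cmps C al g * mderiv l (?h g k))" for l k
  proof -
    have "euler (mderiv l (?h al k)) + mderiv l (?h al k) + mderiv l (?h al k) = mderiv l (euler (?h al k) + ?h al k)"
      by (simp add: euler_mderiv)
    also have "\<dots> = - (\<Sum>g\<in>UNIV. mconst (C g l al) * ?h g k) - (\<Sum>g\<in>UNIV. Cmps C al g * mderiv l (?h g k))"
      unfolding exq_euler by (simp add: mderiv_Cmps sum.distrib)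
    finally show ?thesis .
  qed
  define B where "B = (\<lambda>al. \<Sum>i\<in>UNIV. \<Sum>j\<in>UNIV. mconst (C i j al) * (?h i be * ?h j ga))"
  \<comment> \<open>On a product, E + 2 is the sum of E + 1 acting on each factor.\<close>
  have "euler (B al) + B al + B al
      = (\<Sum>i\<in>UNIV. \<Sum>j\<in>UNIV. mconst (C i j al) * ((euler (?h i be) + ?h i be) * ?h j ga
           + ?h i be * (euler (?h j ga) + ?h j ga)))"
    by (simp add: B_def euler_mult sum.distrib sum_distrib_left algebra_simps)
  also have "\<dots> = (\<Sum>i\<in>UNIV. \<Sum>j\<in>UNIV. mconst (C i j al) * (?d i be * ?h j ga))
      + (\<Sum>i\<in>UNIV. \<Sum>j\<in>UNIV. mconst (C i j al) * (?h i be * ?d j ga))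
      - ((\<Sum>i\<in>UNIV. \<Sum>j\<in>UNIV. \<Sum>m\<in>UNIV. mconst (C i j al) * (Cmps C i m * ?h m be * ?h j ga))
       + (\<Sum>i\<in>UNIV. \<Sum>j\<in>UNIV. \<Sum>m\<in>UNIV. mconst (C i j al) * (?h i be * (Cmps C j m * ?h m ga))))"
    unfolding exq_euler
    by (simp only: left_diff_distrib right_diff_distrib distrib_left distrib_right
        sum_distrib_left sum_distrib_right sum.distrib sum_subtractf) (simp add: algebra_simps)
  also have "(\<Sum>i\<in>UNIV. \<Sum>j\<in>UNIV. mconst (C i j al) * (?d i be * ?h j ga)) = (\<Sum>j\<in>UNIV. mconst (C be j al) * ?h j ga)"
    by (subst sum.swap) (simp add: if_distrib if_distribR cong: if_cong)
  also have "(\<Sum>i\<in>UNIV. \<Sum>j\<in>UNIV. mconst (C i j al) * (?h i be * ?d j ga)) = (\<Sum>i\<in>UNIV. mconst (C i ga al) * ?h i be)"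
    by (simp add: if_distrib if_distribR cong: if_cong)
  \<comment> \<open>Bracketing with p in either slot of a bracket adds up, by the Jacobi identity,
    to bracketing the whole with p.\<close>
  also have "(\<Sum>i\<in>UNIV. \<Sum>j\<in>UNIV. \<Sum>m\<in>UNIV. mconst (C i j al) * (Cmps C i m * ?h m be * ?h j ga))
      + (\<Sum>i\<in>UNIV. \<Sum>j\<in>UNIV. \<Sum>m\<in>UNIV. mconst (C i j al) * (?h i be * (Cmps C j m * ?h m ga)))
    = (\<Sum>g\<in>UNIV. Cmps C al g * B g)"
  proof -
    have "(\<Sum>i\<in>UNIV. \<Sum>j\<in>UNIV. \<Sum>m\<in>UNIV. mconst (C i j al) * (Cmps C i m * ?h m be * ?h j ga))
      = (\<Sum>i\<in>UNIV. \<Sum>j\<in>UNIV. \<Sum>m\<in>UNIV. mconst (C m j al) * Cmps C m i * (?h i be * ?h j ga))"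
    proof -
      have "(\<Sum>i\<in>UNIV. \<Sum>j\<in>UNIV. \<Sum>m\<in>UNIV. mconst (C i j al) * (Cmps C i m * ?h m be * ?h j ga))
          = (\<Sum>j\<in>UNIV. \<Sum>i\<in>UNIV. \<Sum>m\<in>UNIV. mconst (C i j al) * (Cmps C i m * ?h m be * ?h j ga))"
        by (rule sum.swap)
      also have "\<dots> = (\<Sum>j\<in>UNIV. \<Sum>m\<in>UNIV. \<Sum>i\<in>UNIV. mconst (C i j al) * (Cmps C i m * ?h m be * ?h j ga))"
        by (rule sum.cong[OF refl], rule sum.swap)
      also have "\<dots> = (\<Sum>m\<in>UNIV. \<Sum>j\<in>UNIV. \<Sum>i\<in>UNIV. mconst (C i j al) * (Cmps C i m * ?h m be * ?h j ga))"
        by (rule sum.swap)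
      finally show ?thesis by (simp add: mult_ac)
    qed
    moreover have "(\<Sum>i\<in>UNIV. \<Sum>j\<in>UNIV. \<Sum>m\<in>UNIV. mconst (C i j al) * (?h i be * (Cmps C j m * ?h m ga)))
      = (\<Sum>i\<in>UNIV. \<Sum>j\<in>UNIV. \<Sum>m\<in>UNIV. mconst (C i m al) * Cmps C m j * (?h i be * ?h j ga))"
    proof -
      have "(\<Sum>i\<in>UNIV. \<Sum>j\<in>UNIV. \<Sum>m\<in>UNIV. mconst (C i j al) * (?h i be * (Cmps C j m * ?h m ga)))
          = (\<Sum>i\<in>UNIV. \<Sum>m\<in>UNIV. \<Sum>j\<in>UNIV. mconst (C i j al) * (?h i be * (Cmps C j m * ?h m ga)))"
        by (rule sum.cong[OF refl], rule sum.swap)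
      then show ?thesis by (simp add: mult_ac)
    qed
    moreover have "(\<Sum>i\<in>UNIV. \<Sum>j\<in>UNIV. \<Sum>m\<in>UNIV. mconst (C m j al) * Cmps C m i * (?h i be * ?h j ga))
       + (\<Sum>i\<in>UNIV. \<Sum>j\<in>UNIV. \<Sum>m\<in>UNIV. mconst (C i m al) * Cmps C m j * (?h i be * ?h j ga))
      = (\<Sum>i\<in>UNIV. \<Sum>j\<in>UNIV. (\<Sum>m\<in>UNIV. mconst (C m j al) * Cmps C m i + mconst (C i m al) * Cmps C m j) * (?h i be * ?h j ga))"
      by (simp add: sum.distrib sum_distrib_right distrib_right)
    moreover have "\<dots> = (\<Sum>i\<in>UNIV. \<Sum>j\<in>UNIV. \<Sum>g\<in>UNIV. Cmps C al g * (mconst (C i j g) * (?h i be * ?h j ga)))"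
      unfolding jacobi_Cmps[OF lie] by (simp add: sum_distrib_right sum_distrib_left mult_ac)
    moreover have "\<dots> = (\<Sum>i\<in>UNIV. \<Sum>g\<in>UNIV. \<Sum>j\<in>UNIV. Cmps C al g * (mconst (C i j g) * (?h i be * ?h j ga)))"
      by (rule sum.cong[OF refl], rule sum.swap)
    moreover have "\<dots> = (\<Sum>g\<in>UNIV. \<Sum>i\<in>UNIV. \<Sum>j\<in>UNIV. Cmps C al g * (mconst (C i j g) * (?h i be * ?h j ga)))"
      by (rule sum.swap)
    moreover have "\<dots> = (\<Sum>g\<in>UNIV. Cmps C al g * B g)"
      by (simp add: B_def sum_distrib_left)
    ultimately show ?thesis by simp
  qed
  finally have TB: "euler (B al) + B al + B al
      = (\<Sum>j\<in>UNIV. mconst (C be j al) * ?h j ga) + (\<Sum>i\<in>UNIV. mconst (C i ga al) * ?h i be)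
        - (\<Sum>g\<in>UNIV. Cmps C al g * B g)" .
  \<comment> \<open>With this sign the constant-coefficient terms of \<open>T\<close> cancel those
    of \<open>TB\<close>, and only the bracket of p with the defect remains.\<close>
  have S: "(\<Sum>g\<in>UNIV. mconst (C g be al) * ?h g ga) = - (\<Sum>j\<in>UNIV. mconst (C be j al) * ?h j ga)"
    unfolding sum_negf[symmetric]
    by (intro sum.cong refl, subst lie_antisym[OF lie]) (simp add: mconst_uminus)
  have mcdefect: "mcdefect C be ga x = mderiv be (?h x ga) - mderiv ga (?h x be) - B x" for x
    by (simp add: mcdefect_def B_def)
  show ?thesis
    unfolding mcdefect using T[of be ga] T[of ga be] TB S
    by (simp add: algebra_simps sum.distrib sum_subtractf)
qed

text \<open>The entries of C are linear forms, so \<open>mcdefect_euler\<close> expresses n + 2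
  times a coefficient of degree n through coefficients of degree n - 1. Induction on n applies, as n
  + 2 is invertible in characteristic 0.\<close>

lemma mcdefect_eq_0:
  assumes lie: "lie_structure C"
  shows "mcdefect C be ga al = 0"
proof -
  have "coef (mcdefect C be ga al) a = 0" if "mdeg a = n" for n a al
    using that
  proof (induction n arbitrary: a al rule: less_induct)
    case (less n)
    have "coef (euler (mcdefect C be ga al) + mcdefect C be ga al + mcdefect C be ga al) a = 0"
      unfolding mcdefect_euler[OF lie]
    proof -
      have "coef (Cmps C al g * mcdefect C be ga g) a = 0" for g
      proof -
        have "coef (mcdefect C be ga g) (a - unitv r) = 0" if "0 < a r" for r
        proof (rule less.IH[OF _ refl])
          show "mdeg (a - unitv r) < n"
            using that less.prems mdeg_diff[of "unitv r" a] mdeg_mono[of "unitv r" a] by simp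
        qed
        then show ?thesis
          by (auto simp: Cmps_def sum_distrib_right mult.assoc coef_mvar_mult intro!: sum.neutral)
      qed
      then show "coef (- (\<Sum>g\<in>UNIV. Cmps C al g * mcdefect C be ga g)) a = 0" by simp
    qed
    then have "of_nat n * coef (mcdefect C be ga al) a + coef (mcdefect C be ga al) a + coef (mcdefect C be ga al) a = 0"
      unfolding coef_add coef_euler less.prems .
    then have "of_nat (n + 2) * coef (mcdefect C be ga al) a = 0"
      by (simp add: algebra_simps)
    moreover have "of_nat (n + 2) \<noteq> (0 :: 'b)" unfolding of_nat_eq_0_iff by simp
    ultimately show ?case by (metis mult_eq_0_iff)
  qed
  then show ?thesis by (simp add: mps_eq_iff)
qed

section \<open>The vector fields of the star product and of the adjoint action\<close>

lemma delta_mult: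
  "x * (if b then y else 0) = (if b then x * y else 0)"
  "(if b then y else 0) * x = (if b then y * x else 0)"
  for x y :: "'a::mult_zero"
  by auto

definition starfield :: "('n::finite \<Rightarrow> 'n \<Rightarrow> 'n \<Rightarrow> 'k::field_char_0) \<Rightarrow> 'n \<Rightarrow> ('n, 'k) mps \<Rightarrow> ('n, 'k) mps" where
  "starfield C mu D = (\<Sum>al\<in>UNIV. Ceval C bern_fps al mu * mderiv al D)"

text \<open>The transpose of \<^const>\<open>Mop\<close>.\<close>

definition adfield :: "('n::finite \<Rightarrow> 'n \<Rightarrow> 'n \<Rightarrow> 'k::field_char_0) \<Rightarrow> 'n \<Rightarrow> ('n, 'k) mps \<Rightarrow> ('n, 'k) mps" where
  "adfield C mu D = (\<Sum>l\<in>UNIV. Cmps C l mu * mderiv l D)"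

lemma starfield_add: "starfield C mu (P + Q) = starfield C mu P + starfield C mu Q"
  and starfield_diff: "starfield C mu (P - Q) = starfield C mu P - starfield C mu Q"
  and starfield_sum: "starfield C mu (sum R A) = (\<Sum>x\<in>A. starfield C mu (R x))"
  and starfield_mult: "starfield C mu (P * Q) = starfield C mu P * Q + P * starfield C mu Q"
  and starfield_zero: "starfield C mu 0 = 0"
  and starfield_one: "starfield C mu 1 = 0"
  and starfield_mconst_mult: "starfield C mu (mconst c * P) = mconst c * starfield C mu P"
      apply (simp_all add: starfield_def sum.distrib sum_subtractf sum_distrib_left sum_distrib_right algebra_simps)
  by (rule sum.swap)

lemma adfield_sum: "adfield C mu (sum R A) = (\<Sum>x\<in>A. adfield C mu (R x))"
  and adfield_mult: "adfield C mu (P * Q) = adfield C mu P * Q + P * adfield C mu Q"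
  and adfield_one: "adfield C mu 1 = 0"
  and adfield_zero: "adfield C mu 0 = 0"
      apply (simp_all add: adfield_def sum.distrib sum_distrib_left sum_distrib_right algebra_simps)
  by (rule sum.swap)

text \<open>The second-order parts cancel because partial derivatives commute, so the commutator of
  two vector fields is again a vector field.\<close>

lemma comm_fields:
  fixes u v :: "'n::finite \<Rightarrow> ('n, 'k::field_char_0) mps"
  shows "(\<Sum>a\<in>UNIV. u a * mderiv a (\<Sum>b\<in>UNIV. v b * mderiv b D)) - (\<Sum>a\<in>UNIV. v a * mderiv a (\<Sum>b\<in>UNIV. u b * mderiv b D))
    = (\<Sum>b\<in>UNIV. ((\<Sum>a\<in>UNIV. u a * mderiv a (v b)) - (\<Sum>a\<in>UNIV. v a * mderiv a (u b))) * mderiv b D)"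
proof -
  have E: "(\<Sum>a\<in>UNIV. u a * mderiv a (\<Sum>b\<in>UNIV. v b * mderiv b D))
     = (\<Sum>b\<in>UNIV. (\<Sum>a\<in>UNIV. u a * mderiv a (v b)) * mderiv b D) + (\<Sum>a\<in>UNIV. \<Sum>b\<in>UNIV. u a * v b * mderiv a (mderiv b D))"
    for u v :: "'n \<Rightarrow> ('n, 'k) mps"
  proof -
    have "(\<Sum>a\<in>UNIV. u a * mderiv a (\<Sum>b\<in>UNIV. v b * mderiv b D))
      = (\<Sum>a\<in>UNIV. \<Sum>b\<in>UNIV. u a * mderiv a (v b) * mderiv b D) + (\<Sum>a\<in>UNIV. \<Sum>b\<in>UNIV. u a * v b * mderiv a (mderiv b D))"
      by (simp add: sum_distrib_left sum.distrib distrib_left mult.assoc)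
    also have "(\<Sum>a\<in>UNIV. \<Sum>b\<in>UNIV. u a * mderiv a (v b) * mderiv b D) = (\<Sum>b\<in>UNIV. (\<Sum>a\<in>UNIV. u a * mderiv a (v b)) * mderiv b D)"
      by (subst sum.swap) (simp add: sum_distrib_right)
    finally show ?thesis .
  qed
  have "(\<Sum>a\<in>UNIV. \<Sum>b\<in>UNIV. u a * v b * mderiv a (mderiv b D)) = (\<Sum>a\<in>UNIV. \<Sum>b\<in>UNIV. v a * u b * mderiv a (mderiv b D))"
    by (subst sum.swap) (simp add: mderiv_commute mult_ac)
  then show ?thesis
    unfolding E[of u v] E[of v u] by (simp add: sum_subtractf left_diff_distrib)
qed

lemma Ceval_bern_exq:
  "(\<Sum>g\<in>UNIV. Ceval C bern_fps al g * Ceval C exq_fps g be) = (if al = be then 1 else 0)"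
  "(\<Sum>g\<in>UNIV. Ceval C exq_fps al g * Ceval C bern_fps g be) = (if al = be then 1 else 0)"
  by (simp_all only: Ceval_mult[symmetric] bern_exq mult.commute[of exq_fps] Ceval_1)

text \<open>These are the coefficients of the commutator of two of the fields. Contracting them with
  the dual forms \<open>?h\<close> moves the derivatives from \<open>?p\<close> to
  \<open>?h\<close>, where the structure equation evaluates them to constants; multiplying by
  \<open>?p\<close> undoes the contraction.\<close>

lemma starfield_Ceval_bern:
  assumes lie: "lie_structure C"
  shows "starfield C mu (Ceval C bern_fps al nu) - starfield C nu (Ceval C bern_fps al mu)
    = - (\<Sum>k\<in>UNIV. mconst (C mu nu k) * Ceval C bern_fps al k)"
proof -
  let ?h = "Ceval C exq_fps" and ?p = "Ceval C bern_fps"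
  have P: "(\<Sum>al\<in>UNIV. \<Sum>be\<in>UNIV. c * (A be * B al)) = c * (sum A UNIV * sum B UNIV)"
    for c :: "('a, 'b) mps" and A B :: "'a \<Rightarrow> ('a, 'b) mps"
    unfolding sum_product unfolding sum_distrib_left by (rule sum.swap)
  define W where "W = (\<lambda>al. starfield C mu (?p al nu) - starfield C nu (?p al mu))"
  \<comment> \<open>Product rule applied to the constant matrix product of \<open>?h\<close> and
    \<open>?p\<close>.\<close>
  have hV: "(\<Sum>al\<in>UNIV. ?h g al * starfield C a (?p al b)) = - (\<Sum>al\<in>UNIV. \<Sum>be\<in>UNIV. ?p be a * ?p al b * mderiv be (?h g al))" for g a b
  proof -
    have "starfield C a (\<Sum>al\<in>UNIV. ?h g al * ?p al b) = 0"
      unfolding Ceval_bern_exq by (simp add: starfield_one starfield_zero)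
    then have "(\<Sum>al\<in>UNIV. ?h g al * starfield C a (?p al b)) = - (\<Sum>al\<in>UNIV. starfield C a (?h g al) * ?p al b)"
      by (simp add: starfield_sum starfield_mult sum.distrib eq_neg_iff_add_eq_0 add.commute)
    then show ?thesis
      by (simp add: starfield_def sum_distrib_left sum_distrib_right mult_ac)
  qed
  have hW: "(\<Sum>al\<in>UNIV. ?h g al * W al) = - mconst (C mu nu g)" for g
  proof -
    have "(\<Sum>al\<in>UNIV. ?h g al * W al)
       = (\<Sum>al\<in>UNIV. \<Sum>be\<in>UNIV. ?p be nu * ?p al mu * mderiv be (?h g al))
        - (\<Sum>al\<in>UNIV. \<Sum>be\<in>UNIV. ?p be mu * ?p al nu * mderiv be (?h g al))"
      by (simp add: W_def right_diff_distrib sum_subtractf hV)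
    also have "(\<Sum>al\<in>UNIV. \<Sum>be\<in>UNIV. ?p be nu * ?p al mu * mderiv be (?h g al))
       = (\<Sum>al\<in>UNIV. \<Sum>be\<in>UNIV. ?p be mu * ?p al nu * mderiv al (?h g be))"
      by (subst sum.swap) (simp add: mult_ac)
    also have "\<dots> - (\<Sum>al\<in>UNIV. \<Sum>be\<in>UNIV. ?p be mu * ?p al nu * mderiv be (?h g al))
       = - (\<Sum>al\<in>UNIV. \<Sum>be\<in>UNIV. ?p be mu * ?p al nu * (mderiv be (?h g al) - mderiv al (?h g be)))"
      by (simp add: right_diff_distrib sum_subtractf)
    \<comment> \<open>The vanishing of \<open>mcdefect\<close> replaces antisymmetrized derivatives
      by brackets of the forms.\<close>
    also have "\<dots> = - (\<Sum>al\<in>UNIV. \<Sum>be\<in>UNIV. ?p be mu * ?p al nu *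
          (\<Sum>i\<in>UNIV. \<Sum>j\<in>UNIV. mconst (C i j g) * (?h i be * ?h j al)))"
      using mcdefect_eq_0[OF lie] by (simp add: mcdefect_def)
    also have "(\<Sum>al\<in>UNIV. \<Sum>be\<in>UNIV. ?p be mu * ?p al nu *
          (\<Sum>i\<in>UNIV. \<Sum>j\<in>UNIV. mconst (C i j g) * (?h i be * ?h j al)))
        = (\<Sum>al\<in>UNIV. \<Sum>be\<in>UNIV. \<Sum>i\<in>UNIV. \<Sum>j\<in>UNIV. mconst (C i j g) * ((?h i be * ?p be mu) * (?h j al * ?p al nu)))"
      by (simp add: sum_distrib_left mult_ac)
    \<comment> \<open>The sums are reordered until \<open>al\<close> and \<open>be\<close> are
      innermost, where the products of \<open>?h\<close> and \<open>?p\<close> collapse to the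
      identity matrix.\<close>
    also have "\<dots> = (\<Sum>al\<in>UNIV. \<Sum>i\<in>UNIV. \<Sum>be\<in>UNIV. \<Sum>j\<in>UNIV. mconst (C i j g) * ((?h i be * ?p be mu) * (?h j al * ?p al nu)))"
      by (rule sum.cong[OF refl], rule sum.swap)
    also have "\<dots> = (\<Sum>i\<in>UNIV. \<Sum>al\<in>UNIV. \<Sum>be\<in>UNIV. \<Sum>j\<in>UNIV. mconst (C i j g) * ((?h i be * ?p be mu) * (?h j al * ?p al nu)))"
      by (rule sum.swap)
    also have "\<dots> = (\<Sum>i\<in>UNIV. \<Sum>al\<in>UNIV. \<Sum>j\<in>UNIV. \<Sum>be\<in>UNIV. mconst (C i j g) * ((?h i be * ?p be mu) * (?h j al * ?p al nu)))"
      by (rule sum.cong[OF refl], rule sum.cong[OF refl], rule sum.swap)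
    also have "\<dots> = (\<Sum>i\<in>UNIV. \<Sum>j\<in>UNIV. \<Sum>al\<in>UNIV. \<Sum>be\<in>UNIV. mconst (C i j g) * ((?h i be * ?p be mu) * (?h j al * ?p al nu)))"
      by (rule sum.cong[OF refl], rule sum.swap)
    also have "\<dots> = (\<Sum>i\<in>UNIV. \<Sum>j\<in>UNIV. mconst (C i j g) *
          ((\<Sum>be\<in>UNIV. ?h i be * ?p be mu) * (\<Sum>al\<in>UNIV. ?h j al * ?p al nu)))"
      by (rule sum.cong[OF refl], rule sum.cong[OF refl], rule P)
    also have "\<dots> = (\<Sum>i\<in>UNIV. if i = mu then \<Sum>j\<in>UNIV. if j = nu then mconst (C i j g) else 0 else 0)"
      unfolding Ceval_bern_exq by (intro sum.cong refl) (simp add: delta_mult)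
    also have "\<dots> = mconst (C mu nu g)"
      by simp
    finally show ?thesis .
  qed
  have "W al = (\<Sum>b\<in>UNIV. (\<Sum>g\<in>UNIV. ?p al g * ?h g b) * W b)"
    unfolding Ceval_bern_exq by (simp add: delta_mult)
  also have "\<dots> = (\<Sum>g\<in>UNIV. ?p al g * (\<Sum>b\<in>UNIV. ?h g b * W b))"
    unfolding sum_distrib_left sum_distrib_right mult.assoc by (rule sum.swap)
  also have "\<dots> = - (\<Sum>k\<in>UNIV. mconst (C mu nu k) * ?p al k)"
    unfolding hW by (simp add: sum_negf mult.commute)
  finally show ?thesis unfolding W_def .
qed

text \<open>The sign is opposite to that of the bracket, as it must be for transposes of left
  multiplications.\<close>

lemma starfield_comm:
  assumes lie: "lie_structure C"
  shows "starfield C mu (starfield C nu D) - starfield C nu (starfield C mu D) = - (\<Sum>k\<in>UNIV. mconst (C mu nu k) * starfield C k D)"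
proof -
  have "starfield C mu (starfield C nu D) - starfield C nu (starfield C mu D)
      = (\<Sum>b\<in>UNIV. (starfield C mu (Ceval C bern_fps b nu) - starfield C nu (Ceval C bern_fps b mu)) * mderiv b D)"
    unfolding starfield_def by (rule comm_fields)
  also have "\<dots> = - (\<Sum>b\<in>UNIV. \<Sum>k\<in>UNIV. mconst (C mu nu k) * (Ceval C bern_fps b k * mderiv b D))"
    unfolding starfield_Ceval_bern[OF lie] by (simp add: sum_distrib_right sum_negf mult.assoc)
  also have "(\<Sum>b\<in>UNIV. \<Sum>k\<in>UNIV. mconst (C mu nu k) * (Ceval C bern_fps b k * mderiv b D))
      = (\<Sum>k\<in>UNIV. mconst (C mu nu k) * starfield C k D)"
    by (subst sum.swap) (simp add: starfield_def sum_distrib_left)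
  finally show ?thesis .
qed

section \<open>Euler's identity for the star product fields\<close>

lemma fps_split: "(F :: 'k::field fps) = fps_const (fps_nth F 0) + fps_shift (Suc 0) F * fps_X"
  by (rule fps_ext) simp

text \<open>From F = 1 + t S. The factor C split off can stand on either side: on the right it
  annihilates the vector of variables, on the left it supplies the coefficients of
  \<open>adfield\<close>.\<close>

lemma Ceval_split:
  assumes "fps_nth F 0 = 1"
  shows "Ceval C F al be = (if al = be then 1 else 0) + (\<Sum>g\<in>UNIV. Ceval C (fps_shift (Suc 0) F) al g * Cmps C g be)"
    "Ceval C F al be = (if al = be then 1 else 0) + (\<Sum>g\<in>UNIV. Cmps C al g * Ceval C (fps_shift (Suc 0) F) g be)"
proof -
  have F: "F = 1 + fps_shift (Suc 0) F * fps_X" using fps_split[of F] assms by simp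
  show "Ceval C F al be = (if al = be then 1 else 0) + (\<Sum>g\<in>UNIV. Ceval C (fps_shift (Suc 0) F) al g * Cmps C g be)"
    by (subst F) (simp only: Ceval_add Ceval_1 Ceval_mult Ceval_X)
  have F: "F = 1 + fps_X * fps_shift (Suc 0) F" using F by (simp add: mult.commute)
  show "Ceval C F al be = (if al = be then 1 else 0) + (\<Sum>g\<in>UNIV. Cmps C al g * Ceval C (fps_shift (Suc 0) F) g be)"
    by (subst F) (simp only: Ceval_add Ceval_1 Ceval_mult Ceval_X)
qed

lemma double_eq_0:
  fixes P :: "('n::finite, 'k::field_char_0) mps"
  assumes "P + P = 0"
  shows "P = 0"
  unfolding mps_eq_iff
proof
  fix a
  have "2 * coef P a = coef (P + P) a" unfolding coef_add by simp
  then show "coef P a = coef 0 a" unfolding assms by simp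
qed

text \<open>This is [p, p] = 0: antisymmetric structure constants are summed against the symmetric
  products of variables.\<close>

lemma Cmps_mvar:
  assumes lie: "lie_structure C"
  shows "(\<Sum>i\<in>UNIV. Cmps C al i * mvar i) = 0"
proof -
  let ?S = "\<Sum>i\<in>UNIV. \<Sum>r\<in>UNIV. mconst (C i r al) * (mvar r * mvar i) :: ('a, 'b) mps"
  have "?S = (\<Sum>i\<in>UNIV. \<Sum>r\<in>UNIV. mconst (C r i al) * (mvar r * mvar i))"
    by (subst sum.swap) (simp add: mult_ac)
  also have "\<dots> = - ?S"
    unfolding sum_negf[symmetric]
    by (intro sum.cong refl, subst lie_antisym[OF lie]) (simp add: mconst_uminus)
  finally have "?S + ?S = 0" by simp
  then have "?S = 0" by (rule double_eq_0)
  then show ?thesis by (simp add: Cmps_def sum_distrib_right mult.assoc)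
qed

text \<open>The matrix of the fields is 1 + S(C) C, and C annihilates the vector of variables, so
  this matrix fixes that vector.\<close>

lemma euler_starfield:
  assumes lie: "lie_structure C"
  shows "(\<Sum>i\<in>UNIV. mvar i * starfield C i D) = euler D"
proof -
  have "(\<Sum>i\<in>UNIV. Ceval C bern_fps al i * mvar i) = mvar al" for al
  proof -
    have "(\<Sum>i\<in>UNIV. Ceval C bern_fps al i * mvar i)
       = (\<Sum>i\<in>UNIV. (if al = i then 1 else 0) * mvar i) + (\<Sum>i\<in>UNIV. \<Sum>g\<in>UNIV. Ceval C (fps_shift (Suc 0) bern_fps) al g * (Cmps C g i * mvar i))"
      by (subst Ceval_split(1)[OF bern_fps_0]) (simp add: distrib_right sum.distrib sum_distrib_right mult.assoc)
    also have "(\<Sum>i\<in>UNIV. \<Sum>g\<in>UNIV. Ceval C (fps_shift (Suc 0) bern_fps) al g * (Cmps C g i * mvar i)) = 0"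
      by (subst sum.swap) (simp add: Cmps_mvar[OF lie] flip: sum_distrib_left)
    also have "(\<Sum>i\<in>UNIV. (if al = i then 1 else 0) * mvar i) = (\<Sum>i\<in>UNIV. if al = i then mvar i else 0 :: ('a, 'b) mps)"
      by (intro sum.cong) auto
    finally show ?thesis by simp
  qed
  note * = this
  have "(\<Sum>i\<in>UNIV. mvar i * starfield C i D) = (\<Sum>al\<in>UNIV. (\<Sum>i\<in>UNIV. Ceval C bern_fps al i * mvar i) * mderiv al D)"
    unfolding starfield_def sum_distrib_left sum_distrib_right by (subst sum.swap) (simp add: mult_ac)
  then show ?thesis unfolding * euler_def .
qed

text \<open>The field moves p in the direction of [x_mu, p], and \<open>ad [x_mu, p]\<close> is the
  commutator of \<open>ad x_mu\<close> with \<open>ad p\<close>. Below, A denotes the matrix of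
  \<open>ad x_mu\<close>, with entry \<open>C mu s l\<close> in row \<open>l\<close> and column
  \<open>s\<close>.\<close>

lemma adfield_Cmps:
  assumes lie: "lie_structure C"
  shows "adfield C mu (Cmps C l b) = (\<Sum>s\<in>UNIV. mconst (C mu s l) * Cmps C s b) - (\<Sum>s\<in>UNIV. Cmps C l s * mconst (C mu b s))"
proof -
  have "(\<Sum>m\<in>UNIV. mconst (C m mu l) * Cmps C m b) = - (\<Sum>m\<in>UNIV. mconst (C mu m l) * Cmps C m b)"
    "(\<Sum>m\<in>UNIV. mconst (C b mu m) * Cmps C l m) = - (\<Sum>m\<in>UNIV. mconst (C mu b m) * Cmps C l m)"
    unfolding sum_negf[symmetric]
    by (intro sum.cong refl, subst lie_antisym[OF lie], simp add: mconst_uminus)+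
  then show ?thesis
    using jacobi_Cmps[OF lie, where i = b and j = mu and al = l]
    by (simp add: adfield_def mderiv_Cmps sum.distrib mult.commute algebra_simps)
qed

lemma adfield_Cmpow:
  assumes lie: "lie_structure C"
  shows "adfield C mu (Cmpow C N l b) = (\<Sum>s\<in>UNIV. mconst (C mu s l) * Cmpow C N s b) - (\<Sum>s\<in>UNIV. Cmpow C N l s * mconst (C mu b s))"
proof (induction N arbitrary: b)
  case 0
  show ?case by (simp add: Cmpow_0 delta_mult adfield_one adfield_zero)
next
  case (Suc N)
  have "adfield C mu (Cmpow C (Suc N) l b)
     = (\<Sum>g\<in>UNIV. adfield C mu (Cmpow C N l g) * Cmps C g b) + (\<Sum>g\<in>UNIV. Cmpow C N l g * adfield C mu (Cmps C g b))"
    by (simp add: Cmpow_Suc adfield_sum adfield_mult sum.distrib)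
  also have "(\<Sum>g\<in>UNIV. adfield C mu (Cmpow C N l g) * Cmps C g b)
     = (\<Sum>s\<in>UNIV. mconst (C mu s l) * Cmpow C (Suc N) s b) - (\<Sum>g\<in>UNIV. \<Sum>s\<in>UNIV. Cmpow C N l s * mconst (C mu g s) * Cmps C g b)"
  proof -
    have "(\<Sum>g\<in>UNIV. \<Sum>s\<in>UNIV. mconst (C mu s l) * Cmpow C N s g * Cmps C g b) = (\<Sum>s\<in>UNIV. mconst (C mu s l) * Cmpow C (Suc N) s b)"
      by (subst sum.swap) (simp add: Cmpow_Suc sum_distrib_left mult.assoc)
    then show ?thesis
      unfolding Suc by (simp add: left_diff_distrib sum_subtractf sum_distrib_right)
  qed
  also have "(\<Sum>g\<in>UNIV. Cmpow C N l g * adfield C mu (Cmps C g b))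
     = (\<Sum>g\<in>UNIV. \<Sum>s\<in>UNIV. Cmpow C N l g * mconst (C mu s g) * Cmps C s b) - (\<Sum>s\<in>UNIV. Cmpow C (Suc N) l s * mconst (C mu b s))"
  proof -
    have "(\<Sum>g\<in>UNIV. \<Sum>s\<in>UNIV. Cmpow C N l g * Cmps C g s * mconst (C mu b s)) = (\<Sum>s\<in>UNIV. Cmpow C (Suc N) l s * mconst (C mu b s))"
      by (subst sum.swap) (simp add: Cmpow_Suc sum_distrib_right)
    then show ?thesis
      unfolding adfield_Cmps[OF lie] by (simp add: right_diff_distrib sum_subtractf sum_distrib_left mult.assoc)
  qed
  \<comment> \<open>The two middle sums are the same entry of C^N A C and cancel.\<close>
  also have "(\<Sum>g\<in>UNIV. \<Sum>s\<in>UNIV. Cmpow C N l g * mconst (C mu s g) * Cmps C s b)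
     = (\<Sum>g\<in>UNIV. \<Sum>s\<in>UNIV. Cmpow C N l s * mconst (C mu g s) * Cmps C g b)"
    by (rule sum.swap)
  finally show ?case by simp
qed

text \<open>A linear vector field preserves the degree. In each degree a power series in C may
  therefore be replaced by a multiple of one power of C.\<close>

lemma adfield_cong_mdeg:
  assumes "\<And>b. mdeg b = mdeg a \<Longrightarrow> coef P b = coef Q b"
  shows "coef (adfield C mu P) a = coef (adfield C mu Q) a"
proof -
  have "coef (Cmps C l mu * mderiv l P) a = coef (Cmps C l mu * mderiv l Q) a" for l
  proof -
    have "coef (mderiv l P) (a - unitv r) = coef (mderiv l Q) (a - unitv r)" if "0 < a r" for r
    proof -
      have "mdeg (a - unitv r + unitv l) = mdeg a"
        using that mdeg_diff[of "unitv r" a] mdeg_mono[of "unitv r" a] by simp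
      then show ?thesis unfolding coef_mderiv by (simp add: assms)
    qed
    then show ?thesis
      by (auto simp: Cmps_def sum_distrib_right mult.assoc coef_mvar_mult intro!: sum.cong)
  qed
  then show ?thesis by (simp add: adfield_def)
qed

lemma adfield_Ceval:
  assumes lie: "lie_structure C"
  shows "adfield C mu (Ceval C F l b) = (\<Sum>s\<in>UNIV. mconst (C mu s l) * Ceval C F s b) - (\<Sum>s\<in>UNIV. Ceval C F l s * mconst (C mu b s))"
proof -
  have "coef (adfield C mu (Ceval C F l b)) a
     = coef ((\<Sum>s\<in>UNIV. mconst (C mu s l) * Ceval C F s b) - (\<Sum>s\<in>UNIV. Ceval C F l s * mconst (C mu b s))) a" for a
  proof -
    have "coef (adfield C mu (Ceval C F l b)) a = coef (adfield C mu (mconst (fps_nth F (mdeg a)) * Cmpow C (mdeg a) l b)) a"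
      by (rule adfield_cong_mdeg) (simp add: coef_Ceval)
    also have "adfield C mu (mconst (fps_nth F (mdeg a)) * Cmpow C (mdeg a) l b) = mconst (fps_nth F (mdeg a)) * adfield C mu (Cmpow C (mdeg a) l b)"
      by (simp add: adfield_def sum_distrib_left mult_ac)
    finally show ?thesis
      unfolding adfield_Cmpow[OF lie] mult.commute[of _ "mconst (C mu b _)"]
      by (simp add: coef_Ceval right_diff_distrib sum_distrib_left mult_ac)
  qed
  then show ?thesis by (simp add: mps_eq_iff)
qed

text \<open>With phi for the matrix of the star product fields, differentiating the linear
  coefficients of \<open>adfield\<close> along \<open>starfield C nu\<close> gives A phi, and
  differentiating phi along \<open>adfield C mu\<close> gives A phi - phi A. The difference is phi
  A.\<close>

lemma starfield_adfield_comm: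
  assumes lie: "lie_structure C"
  shows "starfield C nu (adfield C mu D) - adfield C mu (starfield C nu D)
    = (\<Sum>l\<in>UNIV. (\<Sum>s\<in>UNIV. Ceval C bern_fps l s * mconst (C mu nu s)) * mderiv l D)"
proof -
  have Cmps: "starfield C nu (Cmps C l mu) = (\<Sum>s\<in>UNIV. mconst (C mu s l) * Ceval C bern_fps s nu)" for l
    by (simp add: starfield_def mderiv_Cmps mult.commute)
  have "starfield C nu (adfield C mu D) - adfield C mu (starfield C nu D)
      = (\<Sum>l\<in>UNIV. (starfield C nu (Cmps C l mu) - adfield C mu (Ceval C bern_fps l nu)) * mderiv l D)"
    unfolding starfield_def adfield_def by (rule comm_fields)
  then show ?thesis
    unfolding adfield_Ceval[OF lie] Cmps by simp
qed

text \<open>The square bracket defining chi is A C^(N-1) minus the derivative of C^(N-1) along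
  \<open>adfield C mu\<close>, that is, C^(N-1) A. Summation over N gives S(C) A with S =
  (\<open>bern_fps\<close> - 1)/t.\<close>

lemma Ceval_chi:
  assumes lie: "lie_structure C"
  shows "Mps (chi C tau mu nu) = (\<Sum>s\<in>UNIV. Ceval C (fps_shift (Suc 0) bern_fps) tau s * mconst (C mu nu s))"
proof -
  have "chi C tau mu nu a = coef (\<Sum>s\<in>UNIV. Ceval C (fps_shift (Suc 0) bern_fps) tau s * mconst (C mu nu s)) a" for a
  proof -
    define K where "K = (\<lambda>N. \<Sum>s\<in>UNIV. Cmpow C N tau s * mconst (C mu nu s))"
    have K0: "coef (K N) a = 0" if "N \<noteq> mdeg a" for N
      using that homog_Cmpow[of N C tau]
      by (auto simp: K_def homog_def mult.commute[of _ "mconst _"] intro!: sum.neutral)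
    have K: "(\<Sum>al\<in>UNIV. C mu al tau * Cpow C N al nu a)
       - (\<Sum>al\<in>UNIV. ps_mult (ps_deriv al (Cpow C N tau nu)) (Cmat C al mu) a) = coef (K N) a" for N
    proof -
      have "(\<Sum>al\<in>UNIV. ps_mult (ps_deriv al (Cpow C N tau nu)) (Cmat C al mu) a) = coef (adfield C mu (Cmpow C N tau nu)) a"
        unfolding adfield_def mult.commute[of "Cmps _ _ _"]
        by (simp add: mderiv_def Cmpow_def times_mps.rep_eq flip: Mps_Cmat)
      moreover have "(\<Sum>al\<in>UNIV. C mu al tau * Cpow C N al nu a) = coef (\<Sum>s\<in>UNIV. mconst (C mu s tau) * Cmpow C N s nu) a"
        by (simp add: Cmpow_def)
      ultimately show ?thesis
        unfolding adfield_Cmpow[OF lie] K_def by simp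
    qed
    have "chi C tau mu nu a = Sum_any (\<lambda>N. if 1 \<le> N then (-1)^N * bernoulli N / fact N * coef (K (N - 1)) a else 0)"
      unfolding chi_def K ..
    \<comment> \<open>By homogeneity of C^(N-1), only \<open>N - 1 = mdeg a\<close> contributes to
      this coefficient.\<close>
    also have "\<dots> = (\<Sum>N\<in>{Suc (mdeg a)}. if 1 \<le> N then (-1)^N * bernoulli N / fact N * coef (K (N - 1)) a else 0)"
    proof (rule Sum_any.expand_superset)
      show "{N. (if 1 \<le> N then (-1)^N * bernoulli N / fact N * coef (K (N - 1)) a else 0) \<noteq> 0} \<subseteq> {Suc (mdeg a)}"
      proof
        fix N assume "N \<in> {N. (if 1 \<le> N then (-1)^N * bernoulli N / fact N * coef (K (N - 1)) a else 0) \<noteq> 0}"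
        then have "1 \<le> N" "coef (K (N - 1)) a \<noteq> 0" by (auto split: if_splits)
        with K0[of "N - 1"] show "N \<in> {Suc (mdeg a)}" by fastforce
      qed
    qed simp
    also have "\<dots> = fps_nth bern_fps (Suc (mdeg a)) * coef (K (mdeg a)) a"
      by (simp add: bern_fps_def del: fact_Suc)
    also have "\<dots> = coef (\<Sum>s\<in>UNIV. Ceval C (fps_shift (Suc 0) bern_fps) tau s * mconst (C mu nu s)) a"
      unfolding K_def mult.commute[of _ "mconst _"] by (simp add: coef_Ceval sum_distrib_left mult_ac)
    finally show ?thesis .
  qed
  then show ?thesis by (simp add: mps_eq_iff)
qed

text \<open>The coefficients of \<open>adfield\<close> put a factor C in front of S(C) A, and C S(C)
  A = phi A - A. Here phi A is the commutator of the two fields, and the column \<open>nu\<close> of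
  A holds the constants \<open>C mu nu l\<close>.\<close>

lemma chi_adfield:
  assumes lie: "lie_structure C"
  shows "(\<Sum>tau\<in>UNIV. Mps (chi C tau mu nu) * adfield C tau D)
    = (starfield C nu (adfield C mu D) - adfield C mu (starfield C nu D)) - (\<Sum>l\<in>UNIV. mconst (C mu nu l) * mderiv l D)"
proof -
  let ?S = "Ceval C (fps_shift (Suc 0) bern_fps)"
  have "(\<Sum>tau\<in>UNIV. Mps (chi C tau mu nu) * adfield C tau D)
    = (\<Sum>tau\<in>UNIV. \<Sum>l\<in>UNIV. (\<Sum>s\<in>UNIV. Cmps C l tau * ?S tau s * mconst (C mu nu s)) * mderiv l D)"
    unfolding Ceval_chi[OF lie] adfield_def 
    by (simp add: sum_distrib_left sum_distrib_right mult_ac) (rule sum.cong[OF refl], rule sum.swap)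
  also have "\<dots> = (\<Sum>l\<in>UNIV. \<Sum>tau\<in>UNIV. (\<Sum>s\<in>UNIV. Cmps C l tau * ?S tau s * mconst (C mu nu s)) * mderiv l D)"
    by (rule sum.swap)
  also have "\<dots> = (\<Sum>l\<in>UNIV. (\<Sum>s\<in>UNIV. (\<Sum>tau\<in>UNIV. Cmps C l tau * ?S tau s) * mconst (C mu nu s)) * mderiv l D)"
    unfolding sum_distrib_right by (rule sum.cong[OF refl], rule sum.swap)
  also have "\<dots> = (\<Sum>l\<in>UNIV. (\<Sum>s\<in>UNIV. (Ceval C bern_fps l s - (if l = s then 1 else 0)) * mconst (C mu nu s)) * mderiv l D)"
    by (simp add: Ceval_split(2)[OF bern_fps_0, of C])
  also have "\<dots> = (\<Sum>l\<in>UNIV. (\<Sum>s\<in>UNIV. Ceval C bern_fps l s * mconst (C mu nu s)) * mderiv l D) - (\<Sum>l\<in>UNIV. mconst (C mu nu l) * mderiv l D)"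
  proof -
    have "(Ceval C bern_fps l s - (if l = s then 1 else 0)) * mconst (C mu nu s)
        = Ceval C bern_fps l s * mconst (C mu nu s) - (if l = s then mconst (C mu nu s) else 0)" for l s
      by (simp add: left_diff_distrib)
    then show ?thesis by (simp add: sum_subtractf left_diff_distrib)
  qed
  finally show ?thesis unfolding starfield_adfield_comm[OF lie] .
qed

section \<open>Pairing of power series with polynomials\<close>

definition finsupp :: "('a \<Rightarrow> 'k::zero) \<Rightarrow> bool" where
  "finsupp f \<longleftrightarrow> finite {a. f a \<noteq> 0}"

lemma finsupp_superset: "finite A \<Longrightarrow> (\<And>a. f a \<noteq> 0 \<Longrightarrow> a \<in> A) \<Longrightarrow> finsupp f"
  unfolding finsupp_def by (rule finite_subset[of _ A]) auto

lemma finsupp_zero [simp]: "finsupp (\<lambda>_. 0)"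
  by (simp add: finsupp_def)

lemma finsupp_add: "finsupp f \<Longrightarrow> finsupp g \<Longrightarrow> finsupp (\<lambda>a. f a + g a :: 'k::comm_ring_1)"
  by (rule finsupp_superset[of "{a. f a \<noteq> 0} \<union> {a. g a \<noteq> 0}"]) (auto simp: finsupp_def)

lemma finsupp_diff: "finsupp f \<Longrightarrow> finsupp g \<Longrightarrow> finsupp (\<lambda>a. f a - g a :: 'k::comm_ring_1)"
  by (rule finsupp_superset[of "{a. f a \<noteq> 0} \<union> {a. g a \<noteq> 0}"]) (auto simp: finsupp_def)

lemma finsupp_scale: "finsupp f \<Longrightarrow> finsupp (\<lambda>a. c * f a :: 'k::comm_ring_1)"
  by (rule finsupp_superset[of "{a. f a \<noteq> 0}"]) (auto simp: finsupp_def)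

lemma finsupp_sum: "(\<And>x. x \<in> A \<Longrightarrow> finsupp (f x)) \<Longrightarrow> finsupp (\<lambda>a. \<Sum>x\<in>A. f x a :: 'k::comm_ring_1)"
  by (induction A rule: infinite_finite_induct) (auto intro: finsupp_add)

text \<open>Generic in the index type, since it serves both for exponents of polynomials and for
  words of the free algebra.\<close>

definition funpair :: "('a \<Rightarrow> 'k::field) \<Rightarrow> ('a \<Rightarrow> 'k) \<Rightarrow> 'k" where
  "funpair f G = (\<Sum>a | f a \<noteq> 0. f a * G a)"

lemma funpair_superset:
  assumes "finite A" "\<And>a. f a \<noteq> 0 \<Longrightarrow> a \<in> A"
  shows "funpair f G = (\<Sum>a\<in>A. f a * G a)"
  unfolding funpair_def using assms by (intro sum.mono_neutral_left) auto

lemma funpair_zero [simp]: "funpair (\<lambda>_. 0) G = 0"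
  by (simp add: funpair_def)

lemma funpair_add:
  assumes "finsupp f" "finsupp g"
  shows "funpair (\<lambda>a. f a + g a) G = funpair f G + funpair g G"
proof -
  let ?A = "{a. f a \<noteq> 0} \<union> {a. g a \<noteq> 0}"
  have "finite ?A" using assms by (simp add: finsupp_def)
  then show ?thesis
    by (subst (1 2 3) funpair_superset[of ?A]) (auto simp: sum.distrib distrib_right)
qed

lemma funpair_scale:
  assumes "finsupp f"
  shows "funpair (\<lambda>a. c * f a) G = c * funpair f G"
  using assms by (subst (1 2) funpair_superset[of "{a. f a \<noteq> 0}"]) (auto simp: finsupp_def sum_distrib_left mult.assoc)

lemma funpair_diff:
  assumes "finsupp f" "finsupp g"
  shows "funpair (\<lambda>a. f a - g a) G = funpair f G - funpair g G"
  using funpair_add[OF assms(1) finsupp_scale[OF assms(2), of "-1"], of G] funpair_scale[OF assms(2), of "-1" G] by simp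

lemma funpair_sum: "(\<And>x. x \<in> A \<Longrightarrow> finsupp (f x)) \<Longrightarrow> funpair (\<lambda>a. \<Sum>x\<in>A. f x a) G = (\<Sum>x\<in>A. funpair (f x) G)"
proof (induction A rule: infinite_finite_induct)
  case (insert x A)
  have "funpair (\<lambda>a. f x a + (\<Sum>x\<in>A. f x a)) G = funpair (f x) G + funpair (\<lambda>a. \<Sum>x\<in>A. f x a) G"
    using insert by (intro funpair_add finsupp_sum) auto
  with insert show ?case by simp
qed auto

text \<open>The value at 0 of D(\<partial>) f; the weight \<open>mfact a\<close> is what the
  derivative of exponent \<open>a\<close> makes of the monomial of exponent
  \<open>a\<close>.\<close>

definition pair :: "('n::finite, 'k::field_char_0) mps \<Rightarrow> ('n, 'k) poly \<Rightarrow> 'k" where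
  "pair D f = funpair f (\<lambda>a. coef D a * mfact a)"

lemma pair_add_left: "pair (P + Q) f = pair P f + pair Q f"
  and pair_diff_left: "pair (P - Q) f = pair P f - pair Q f"
  and pair_zero_left: "pair 0 f = 0"
  by (simp_all add: pair_def funpair_def algebra_simps sum.distrib sum_subtractf sum_distrib_left)

lemma pair_mconst_left: "pair (mconst c * P) f = c * pair P f"
  by (simp add: pair_def funpair_def sum_distrib_left mult.left_commute mult.assoc)

lemma pair_sum_left: "pair (sum P A) f = (\<Sum>x\<in>A. pair (P x) f)"
  by (induction A rule: infinite_finite_induct) (auto simp: pair_add_left pair_zero_left)

text \<open>The series with the single monomial \<open>m\<close> reads off the coefficient at
  \<open>m\<close>, up to the factor \<open>mfact m\<close>, which is nonzero in characteristic
  0.\<close>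

lemma pair_eqI:
  fixes f g :: "('n::finite, 'k::field_char_0) poly"
  assumes "finsupp f" "finsupp g" "\<And>D. pair D f = pair D g"
  shows "f = g"
proof
  fix m
  have "pair (Mps (\<lambda>a. if a = m then 1 else 0)) h = h m * mfact m" if "finsupp h" for h :: "('n, 'k) poly"
  proof -
    have "pair (Mps (\<lambda>a. if a = m then 1 else 0)) h
        = (\<Sum>a\<in>insert m {a. h a \<noteq> 0}. if a = m then h m * mfact m else 0)"
      unfolding pair_def using that
      by (subst funpair_superset[of "insert m {a. h a \<noteq> 0}"]) (auto simp: finsupp_def delta_mult intro!: sum.cong)
    then show ?thesis using that by (simp add: finsupp_def)
  qed
  from this[OF assms(1)] this[OF assms(2)] assms(3) have "f m * mfact m = g m * mfact m" by metis
  then show "f m = g m" by simp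
qed

section \<open>Transposes of multiplication and differentiation operators\<close>

lemma mulx_conv: "mulx l f m = (if 0 < m l then f (m - unitv l) else 0)"
proof -
  have "(\<lambda>j. if j = l then m j - 1 else m j) = m - unitv l"
    by (auto simp: unitv_def)
  then show ?thesis by (simp add: mulx_def)
qed

lemma pderiv_conv: "pderiv r f m = of_nat (m r + 1) * f (m + unitv r)"
  by (simp add: pderiv_def plus_fun_def)

lemma sub_add_unitv: "0 < m l \<Longrightarrow> m - unitv l + unitv l = m"
  by (auto simp: fun_eq_iff unitv_def)

lemma add_sub_unitv: "m + unitv l - unitv l = (m :: 'n \<Rightarrow> nat)"
  by (auto simp: fun_eq_iff unitv_def)

lemma finsupp_mulx:
  assumes "finsupp f" shows "finsupp (mulx l f)"
proof (rule finsupp_superset[of "(\<lambda>a. a + unitv l) ` {a. f a \<noteq> 0}"])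
  show "finite ((\<lambda>a. a + unitv l) ` {a. f a \<noteq> 0})" using assms by (simp add: finsupp_def)
  fix a assume "mulx l f a \<noteq> 0"
  then have "0 < a l" "f (a - unitv l) \<noteq> 0" by (auto simp: mulx_conv split: if_splits)
  then show "a \<in> (\<lambda>a. a + unitv l) ` {a. f a \<noteq> 0}"
    by (intro image_eqI[of _ _ "a - unitv l"]) (simp_all add: sub_add_unitv)
qed

lemma pair_mulx:
  assumes "finsupp f" shows "pair D (mulx l f) = pair (mderiv l D) f"
proof -
  let ?S = "{a. f a \<noteq> 0}"
  have "pair D (mulx l f) = (\<Sum>a\<in>(\<lambda>a. a + unitv l) ` ?S. mulx l f a * (coef D a * mfact a))"
    unfolding pair_def
  proof (rule funpair_superset)
    show "finite ((\<lambda>a. a + unitv l) ` ?S)" using assms by (simp add: finsupp_def)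
    fix a assume "mulx l f a \<noteq> 0"
    then have "0 < a l" "f (a - unitv l) \<noteq> 0" by (auto simp: mulx_conv split: if_splits)
    then show "a \<in> (\<lambda>a. a + unitv l) ` ?S"
      by (intro image_eqI[of _ _ "a - unitv l"]) (simp_all add: sub_add_unitv)
  qed
  also have "\<dots> = (\<Sum>a\<in>?S. mulx l f (a + unitv l) * (coef D (a + unitv l) * mfact (a + unitv l)))"
    by (subst sum.reindex) (auto intro: inj_onI)
  also have "\<dots> = pair (mderiv l D) f"
    unfolding pair_def funpair_def
  proof (rule sum.cong[OF refl])
    fix a
    have "0 < (a + unitv l) l" by (simp add: unitv_def)
    then show "mulx l f (a + unitv l) * (coef D (a + unitv l) * mfact (a + unitv l)) = f a * (coef (mderiv l D) a * mfact a)"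
      unfolding mulx_conv mfact_add_unitv coef_mderiv add_sub_unitv by simp
  qed
  finally show ?thesis .
qed

lemma finsupp_pderiv:
  assumes "finsupp f" shows "finsupp (pderiv r f)"
proof (rule finsupp_superset[of "(\<lambda>a. a - unitv r) ` {a. f a \<noteq> 0}"])
  show "finite ((\<lambda>a. a - unitv r) ` {a. f a \<noteq> 0})" using assms by (simp add: finsupp_def)
  fix a assume "pderiv r f a \<noteq> 0"
  then have "f (a + unitv r) \<noteq> 0" by (auto simp: pderiv_conv)
  then show "a \<in> (\<lambda>a. a - unitv r) ` {a. f a \<noteq> 0}"
    by (intro image_eqI[of _ _ "a + unitv r"]) (simp_all add: add_sub_unitv del: plus_fun_apply)
qed

lemma pair_pderiv:
  assumes "finsupp f" shows "pair D (pderiv r f) = pair (mvar r * D) f"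
proof -
  \<comment> \<open>Where \<open>a r = 0\<close> the subtraction of \<open>unitv r\<close>
    truncates; on the remaining exponents it is injective.\<close>
  let ?S = "{a. f a \<noteq> 0 \<and> 0 < a r}"
  have fS: "finite ?S" using assms by (simp add: finsupp_def)
  have "pair D (pderiv r f) = (\<Sum>a\<in>(\<lambda>a. a - unitv r) ` ?S. pderiv r f a * (coef D a * mfact a))"
    unfolding pair_def
  proof (rule funpair_superset)
    show "finite ((\<lambda>a. a - unitv r) ` ?S)" using fS by simp
    fix a assume "pderiv r f a \<noteq> 0"
    then have "f (a + unitv r) \<noteq> 0" by (auto simp: pderiv_conv)
    moreover have "0 < (a + unitv r) r" by (simp add: unitv_def)
    ultimately show "a \<in> (\<lambda>a. a - unitv r) ` ?S"
      by (intro image_eqI[of _ _ "a + unitv r"]) (simp_all add: add_sub_unitv del: plus_fun_apply)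
  qed
  also have "\<dots> = (\<Sum>a\<in>?S. pderiv r f (a - unitv r) * (coef D (a - unitv r) * mfact (a - unitv r)))"
    by (subst sum.reindex) (auto intro!: inj_onI, metis sub_add_unitv)
  also have "\<dots> = (\<Sum>a\<in>?S. f a * (coef (mvar r * D) a * mfact a))"
  proof (rule sum.cong[OF refl])
    fix a assume "a \<in> ?S"
    then have a: "0 < a r" by simp
    have "mfact a = of_nat ((a - unitv r) r + 1) * (mfact (a - unitv r) :: 'b)"
      using mfact_add_unitv[of "a - unitv r" r] unfolding sub_add_unitv[of a r, OF a] .
    then show "pderiv r f (a - unitv r) * (coef D (a - unitv r) * mfact (a - unitv r)) = f a * (coef (mvar r * D) a * mfact a)"
      unfolding pderiv_conv coef_mvar_mult sub_add_unitv[of a r, OF a] using a by (simp add: mult_ac)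
  qed
  also have "\<dots> = pair (mvar r * D) f"
    unfolding pair_def using assms
    by (subst funpair_superset[of "{a. f a \<noteq> 0}"]) (auto simp: finsupp_def coef_mvar_mult intro!: sum.mono_neutral_cong_left split: if_splits)
  finally show ?thesis .
qed

lemma le_add_fun: "m \<le> m + (a :: 'n \<Rightarrow> nat)"
  by (simp add: le_fun_def)

lemma add_diff_fun: "m + a - m = (a :: 'n \<Rightarrow> nat)"
  by (simp add: fun_eq_iff)

lemma ps_apply_fct:
  "ps_apply P f m * mfact m = (\<Sum>a | f (m + a) \<noteq> 0. P a * f (m + a) * mfact (m + a))"
  for f :: "('n::finite, 'k::field_char_0) poly"
proof -
  have "(\<Prod>i\<in>UNIV. fact (m i + a i) / fact (m i)) * mfact m = (mfact (m + a) :: 'k)" for a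
    using mfact_nz[of m, where 'k = 'k] by (simp add: prod_dividef mfact_def)
  then show ?thesis
    by (simp add: ps_apply_def sum_distrib_right mult.assoc plus_fun_def)
qed

lemma finite_below_set:
  assumes "finite (S :: ('n::finite \<Rightarrow> nat) set)"
  shows "finite (\<Union>k\<in>S. {..k})"
  using assms by (simp add: finite_below)

lemma ps_apply_supp:
  assumes "ps_apply P f m \<noteq> 0"
  shows "m \<in> (\<Union>k\<in>{a. f a \<noteq> 0}. {..k})"
proof -
  from assms obtain a where "f (\<lambda>i. m i + a i) \<noteq> 0"
    unfolding ps_apply_def by (metis (mono_tags, lifting) mem_Collect_eq sum.not_neutral_contains_not_neutral)
  then show ?thesis by (intro UN_I[of "\<lambda>i. m i + a i"]) (auto simp: le_fun_def)
qed

lemma finsupp_ps_apply: "finsupp f \<Longrightarrow> finsupp (ps_apply P f)"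
  by (rule finsupp_superset[OF finite_below_set ps_apply_supp]) (simp_all add: finsupp_def)

text \<open>Constant-coefficient operators compose by multiplying their series. In coefficients, the
  sum over \<open>m\<close> and \<open>a\<close> is regrouped by \<open>k = m + a\<close>, and the
  factorial quotients in \<open>ps_apply\<close> leave just \<open>mfact k\<close>.\<close>

lemma pair_ps_apply:
  fixes f :: "('n::finite, 'k::field_char_0) poly"
  assumes "finsupp f"
  shows "pair D (ps_apply P f) = pair (Mps P * D) f"
proof -
  let ?S = "{a. f a \<noteq> 0}"
  let ?K = "\<Union>k\<in>?S. {..k}"
  have S: "finite ?S" using assms by (simp add: finsupp_def)
  then have K: "finite ?K" by (rule finite_below_set)
  have fa: "finite {a. f (m + a) \<noteq> 0}" for m
    by (rule finite_subset[of _ "(\<lambda>k. k - m) ` ?S"]) (auto simp: S intro!: image_eqI[of _ _ "m + _"])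
  have "pair D (ps_apply P f) = (\<Sum>m\<in>?K. coef D m * (ps_apply P f m * mfact m))"
    unfolding pair_def by (subst funpair_superset[OF K ps_apply_supp]) (auto simp: mult_ac)
  also have "\<dots> = (\<Sum>(m, a)\<in>(SIGMA m:?K. {a. f (m + a) \<noteq> 0}). coef D m * (P a * f (m + a) * mfact (m + a)))"
    unfolding ps_apply_fct sum_distrib_left by (rule sum.Sigma) (use K fa in auto)
  also have "\<dots> = (\<Sum>(k, m)\<in>(SIGMA k:?S. {..k}). f k * (coef D m * P (k - m) * mfact k))"
    by (rule sum.reindex_bij_witness[of _ "\<lambda>(k, m). (m, k - m)" "\<lambda>(m, a). (m + a, m)"])
       (auto simp: le_add_diff le_add_fun add_diff_fun mult_ac simp del: plus_fun_apply)
  also have "\<dots> = (\<Sum>k\<in>?S. \<Sum>m\<in>{..k}. f k * (coef D m * P (k - m) * mfact k))"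
    by (rule sum.Sigma[symmetric]) (auto simp: S finite_below)
  also have "\<dots> = pair (Mps P * D) f"
    unfolding pair_def funpair_def mult.commute[of "Mps P"]
    by (simp add: coef_mult sum_distrib_left sum_distrib_right)
  finally show ?thesis .
qed

lemma finsupp_Mop: "finsupp f \<Longrightarrow> finsupp (Mop C t f)"
  unfolding Mop_def by (intro finsupp_sum finsupp_scale finsupp_mulx finsupp_pderiv)

lemma pair_Mop:
  assumes "finsupp f"
  shows "pair D (Mop C t f) = pair (adfield C t D) f"
proof -
  have "pair D (Mop C t f) = (\<Sum>l\<in>UNIV. \<Sum>r\<in>UNIV. C t r l * pair D (mulx l (pderiv r f)))"
    unfolding Mop_def pair_def
    using assms by (simp add: funpair_sum funpair_scale finsupp_sum finsupp_scale finsupp_mulx finsupp_pderiv)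
  also have "\<dots> = (\<Sum>l\<in>UNIV. \<Sum>r\<in>UNIV. pair (mconst (C t r l) * (mvar r * mderiv l D)) f)"
    using assms by (simp add: pair_mulx pair_pderiv finsupp_pderiv pair_mconst_left)
  also have "\<dots> = pair (adfield C t D) f"
    by (simp add: adfield_def Cmps_def sum_distrib_right pair_sum_left mult.assoc)
  finally show ?thesis .
qed

section \<open>Symmetrization and the Poincare-Birkhoff-Witt property\<close>

text \<open>Transposition reverses products: the vector field of the first letter is applied first.\<close>

fun wordfield :: "('n::finite \<Rightarrow> 'n \<Rightarrow> 'n \<Rightarrow> 'k::field_char_0) \<Rightarrow> 'n list \<Rightarrow> ('n, 'k) mps \<Rightarrow> ('n, 'k) mps" where
  "wordfield C [] D = D"
| "wordfield C (i # w) D = wordfield C w (starfield C i D)"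

lemma wordfield_append: "wordfield C (u @ v) D = wordfield C v (wordfield C u D)"
  by (induction u arbitrary: D) auto

lemma wordfield_add: "wordfield C w (P + Q) = wordfield C w P + wordfield C w Q"
  and wordfield_diff: "wordfield C w (P - Q) = wordfield C w P - wordfield C w Q"
  and wordfield_mconst: "wordfield C w (mconst c * P) = mconst c * wordfield C w P"
  and wordfield_zero: "wordfield C w 0 = 0"
  by (induction w arbitrary: P Q) (auto simp: starfield_add starfield_diff starfield_mconst_mult starfield_zero)

lemma wordfield_sum: "wordfield C w (sum P A) = (\<Sum>x\<in>A. wordfield C w (P x))"
  by (induction A rule: infinite_finite_induct) (auto simp: wordfield_add wordfield_zero)

definition wordpair :: "('n::finite \<Rightarrow> 'n \<Rightarrow> 'n \<Rightarrow> 'k::field_char_0) \<Rightarrow> ('n, 'k) mps \<Rightarrow> ('n list \<Rightarrow> 'k) \<Rightarrow> 'k" where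
  "wordpair C D p = funpair p (\<lambda>w. coef (wordfield C w D) 0)"

lemma finsupp_word [simp]: "finsupp (word u)"
  by (rule finsupp_superset[of "{u}"]) (auto simp: word_def split: if_splits)

lemma wordpair_word [simp]: "wordpair C D (word u) = coef (wordfield C u D) 0"
  unfolding wordpair_def by (subst funpair_superset[of "{u}"]) (auto simp: word_def split: if_splits)

lemma wprod_word: "wprod (word u) (word v) = word (u @ v)"
proof
  fix w
  have "wprod (word u) (word v) w = (\<Sum>i\<le>length w. if i = length u \<and> w = u @ v then 1 else 0 :: 'b)"
    unfolding wprod_def
  proof (intro sum.cong refl)
    fix k assume "k \<in> {..length w}"
    then have "take k w = u \<and> drop k w = v \<longleftrightarrow> k = length u \<and> w = u @ v"
      by auto
    then show "word u (take k w) * word v (drop k w) = (if k = length u \<and> w = u @ v then 1 else 0 :: 'b)"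
      by (auto simp: word_def)
  qed
  also have "\<dots> = word (u @ v) w"
    by (auto simp: word_def)
  finally show "wprod (word u) (word v) w = (word (u @ v) w :: 'b)" .
qed

lemma wprod_diff_left: "wprod (\<lambda>w. p w - q w) r = (\<lambda>w. wprod p r w - wprod q r w)"
  and wprod_diff_right: "wprod r (\<lambda>w. p w - q w) = (\<lambda>w. wprod r p w - wprod r q w)"
  by (simp_all add: wprod_def fun_eq_iff algebra_simps sum_subtractf)

lemma wprod_sum_left: "wprod (\<lambda>w. \<Sum>k\<in>A. c k * p k w) r = (\<lambda>w. \<Sum>k\<in>A. c k * wprod (p k) r w)"
proof
  fix w
  show "wprod (\<lambda>w. \<Sum>k\<in>A. c k * p k w) r w = (\<Sum>k\<in>A. c k * wprod (p k) r w)"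
    unfolding wprod_def sum_distrib_left sum_distrib_right mult.assoc by (rule sum.swap)
qed

lemma wprod_sum_right: "wprod r (\<lambda>w. \<Sum>k\<in>A. c k * p k w) = (\<lambda>w. \<Sum>k\<in>A. c k * wprod r (p k) w)"
proof
  fix w
  show "wprod r (\<lambda>w. \<Sum>k\<in>A. c k * p k w) w = (\<Sum>k\<in>A. c k * wprod r (p k) w)"
    unfolding wprod_def sum_distrib_left mult.left_commute[of "r _"] by (rule sum.swap)
qed

lemma wprod_rel: "wprod (wprod (word u) (rel C i j)) (word v)
    = (\<lambda>w. word (u @ [i, j] @ v) w - word (u @ [j, i] @ v) w - (\<Sum>k\<in>UNIV. C i j k * word (u @ [k] @ v) w))"
  unfolding rel_def wprod_diff_right wprod_sum_right wprod_diff_left wprod_sum_left wprod_word by simp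

lemma finsupp_wprod_rel: "finsupp (wprod (wprod (word u) (rel C i j)) (word v))"
  unfolding wprod_rel by (intro finsupp_diff finsupp_sum finsupp_scale finsupp_word)

text \<open>The fields of a word act first letter first, so the relator yields the commutator of the
  fields for \<open>i\<close> and \<open>j\<close> in reversed order; this compensates the sign in
  \<open>starfield_comm\<close>.\<close>

lemma wordpair_wprod_rel:
  assumes lie: "lie_structure C"
  shows "wordpair C D (wprod (wprod (word u) (rel C i j)) (word v)) = 0"
proof -
  let ?E = "wordfield C u D"
  have "wordpair C D (wprod (wprod (word u) (rel C i j)) (word v))
      = wordpair C D (word (u @ [i, j] @ v)) - wordpair C D (word (u @ [j, i] @ v)) - (\<Sum>k\<in>UNIV. C i j k * wordpair C D (word (u @ [k] @ v)))"
    unfolding wprod_rel wordpair_def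
    by (simp only: funpair_diff funpair_sum funpair_scale finsupp_diff finsupp_sum finsupp_scale finsupp_word)
  also have "\<dots> = coef (wordfield C v (starfield C j (starfield C i ?E) - starfield C i (starfield C j ?E) - (\<Sum>k\<in>UNIV. mconst (C i j k) * starfield C k ?E))) 0"
    by (simp add: wordfield_append wordfield_diff wordfield_sum wordfield_mconst)
  also have "starfield C j (starfield C i ?E) - starfield C i (starfield C j ?E) = (\<Sum>k\<in>UNIV. mconst (C i j k) * starfield C k ?E)"
    unfolding starfield_comm[OF lie] sum_negf[symmetric]
    by (intro sum.cong refl, subst lie_antisym[OF lie]) (simp add: mconst_uminus)
  finally show ?thesis by (simp add: wordfield_zero)
qed

text \<open>Hence the functional descends to U(g). Finite support is carried through the induction
  because additivity of \<open>funpair\<close> relies on it.\<close>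

lemma wordpair_ideal:
  assumes lie: "lie_structure C" and "p \<in> lie_ideal C"
  shows "finsupp p \<and> wordpair C D p = 0"
  using assms(2)
proof induction
  case zero
  show ?case by (simp add: wordpair_def)
next
  case (step p c u i j v)
  then show ?case
    using wordpair_wprod_rel[OF lie, of D u i j v]
    by (auto simp: wordpair_def finsupp_add finsupp_scale finsupp_wprod_rel funpair_add funpair_scale)
qed

lemma mdeg_wmono [simp]: "mdeg (wmono w) = length w"
  by (simp add: mdeg_def wmono_def sum_count_set)

lemma wmono_Cons: "wmono (i # w) = wmono w + unitv i"
  by (auto simp: wmono_def unitv_def)

lemma finite_wmono: "finite {w. wmono w = (m :: 'n::finite \<Rightarrow> nat)}"
  by (rule finite_subset[OF _ finite_lists_length_eq[of UNIV "mdeg m"]]) auto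

text \<open>Words are sorted by their first letter \<open>i\<close>. Induction turns each group into
  a coefficient of \<open>mvar i * starfield C i D\<close>, and Euler's identity sums these to the
  degree times the coefficient of \<open>D\<close>, which completes the factorial.\<close>

lemma sum_wordfield:
  assumes lie: "lie_structure C"
  shows "(\<Sum>w | wmono w = m. coef (wordfield C w D) 0) = fact (mdeg m) * coef D m"
proof (induction "mdeg m" arbitrary: m D)
  case 0
  then have m: "m = 0" by (metis mdeg_eq_0)
  have W: "{w. wmono w = (0 :: 'a \<Rightarrow> nat)} = {[]}"
    by (auto simp: wmono_def) (metis mdeg_0 mdeg_wmono length_0_conv wmono_def zero_fun_def)
  show ?case unfolding m W mdeg_0 by simp
next
  case (Suc n)
  let ?W = "\<lambda>m. {w :: 'a list. wmono w = m}"
  have W: "?W m = (\<Union>i\<in>{i. 0 < m i}. (#) i ` ?W (m - unitv i))"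
  proof (intro equalityI subsetI)
    fix w assume w: "w \<in> ?W m"
    with Suc.hyps(2) obtain i w' where "w = i # w'" by (cases w) auto
    moreover from this w have "m = wmono w' + unitv i" by (simp add: wmono_Cons)
    ultimately show "w \<in> (\<Union>i\<in>{i. 0 < m i}. (#) i ` ?W (m - unitv i))"
      by (intro UN_I[of i]) (auto simp: add_sub_unitv unitv_def)
  qed (auto simp: wmono_Cons sub_add_unitv simp del: plus_fun_apply)
  have "(\<Sum>w\<in>?W m. coef (wordfield C w D) 0)
      = (\<Sum>i | 0 < m i. \<Sum>w\<in>(#) i ` ?W (m - unitv i). coef (wordfield C w D) 0)"
    by (subst W, rule sum.UNION_disjoint) (auto simp: finite_wmono)
  also have "\<dots> = (\<Sum>i | 0 < m i. fact n * coef (mvar i * starfield C i D) m)"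
  proof (rule sum.cong[OF refl])
    fix i assume "i \<in> {i. 0 < m i}"
    then have i: "0 < m i" by simp
    then have n: "n = mdeg (m - unitv i)"
      using Suc.hyps(2) by (subst mdeg_diff) auto
    have "(\<Sum>w\<in>(#) i ` ?W (m - unitv i). coef (wordfield C w D) 0) = (\<Sum>w\<in>?W (m - unitv i). coef (wordfield C w (starfield C i D)) 0)"
      by (subst sum.reindex) auto
    also have "\<dots> = fact n * coef (starfield C i D) (m - unitv i)"
      using Suc.hyps(1)[OF n] n by simp
    finally show "(\<Sum>w\<in>(#) i ` ?W (m - unitv i). coef (wordfield C w D) 0) = fact n * coef (mvar i * starfield C i D) m"
      using i by (simp add: coef_mvar_mult)
  qed
  also have "\<dots> = (\<Sum>i\<in>UNIV. fact n * coef (mvar i * starfield C i D) m)"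
    by (rule sum.mono_neutral_left) (auto simp: coef_mvar_mult)
  also have "\<dots> = fact n * coef (euler D) m"
    unfolding euler_starfield[OF lie, symmetric] by (simp add: sum_distrib_left)
  finally show ?case
    unfolding coef_euler Suc.hyps(2)[symmetric] by simp
qed

lemma xi_conv: "xi f w = f (wmono w) * mfact (wmono w) / fact (length w)"
  by (simp add: xi_def mfact_def wmono_def)

lemma finsupp_xi:
  assumes "finsupp f" shows "finsupp (xi f)"
  by (rule finsupp_superset[of "\<Union>m\<in>{m. f m \<noteq> 0}. {w. wmono w = m}"])
     (use assms in \<open>auto simp: finsupp_def finite_wmono xi_conv\<close>)

text \<open>Symmetrization gives all words of content \<open>m\<close> the same weight
  \<open>mfact m / fact (mdeg m)\<close>, whose denominator cancels against
  \<open>sum_wordfield\<close>.\<close>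

lemma wordpair_xi:
  assumes lie: "lie_structure C" and f: "finsupp f"
  shows "wordpair C D (xi f) = pair D f"
proof -
  let ?S = "{m. f m \<noteq> 0}"
  have S: "finite ?S" using f by (simp add: finsupp_def)
  have "wordpair C D (xi f) = (\<Sum>w\<in>(\<Union>m\<in>?S. {w. wmono w = m}). xi f w * coef (wordfield C w D) 0)"
    unfolding wordpair_def by (rule funpair_superset) (use S in \<open>auto simp: finite_wmono xi_conv\<close>)
  also have "\<dots> = (\<Sum>m\<in>?S. \<Sum>w | wmono w = m. xi f w * coef (wordfield C w D) 0)"
    by (rule sum.UNION_disjoint) (use S in \<open>auto simp: finite_wmono\<close>)
  also have "\<dots> = (\<Sum>m\<in>?S. \<Sum>w | wmono w = m. f m * mfact m / fact (mdeg m) * coef (wordfield C w D) 0)"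
    by (intro sum.cong refl) (auto simp: xi_conv)
  also have "\<dots> = pair D f"
    unfolding pair_def funpair_def sum_distrib_left[symmetric] sum_wordfield[OF lie] by (simp add: mult_ac)
  finally show ?thesis .
qed

section \<open>Surjectivity of symmetrization\<close>

lemma ideal_add:
  assumes "p \<in> lie_ideal C" "q \<in> lie_ideal C"
  shows "(\<lambda>w. p w + q w) \<in> lie_ideal C"
  using assms(2)
proof induction
  case zero
  then show ?case using assms(1) by simp
next
  case (step q c u i j v)
  from lie_ideal.step[OF step.IH, of c u i j v] show ?case by (simp add: add.assoc)
qed

lemma ideal_scale:
  assumes "p \<in> lie_ideal C"
  shows "(\<lambda>w. d * p w) \<in> lie_ideal C"
  using assms
proof induction
  case zero
  then show ?case by (simp add: lie_ideal.zero)
next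
  case (step p c u i j v)
  from lie_ideal.step[OF step.IH, of "d * c" u i j v] show ?case by (simp add: distrib_left mult.assoc)
qed

lemma ideal_rel: "wprod (wprod (word u) (rel C i j)) (word v) \<in> lie_ideal C"
  using lie_ideal.step[OF lie_ideal.zero, where c = 1] by simp

lemma Spoly_finsupp: "f \<in> Spoly \<longleftrightarrow> finsupp f"
  by (simp add: Spoly_def finsupp_def)

text \<open>That every finitely supported element has this property is the surjectivity of symmetrization onto \<open>U(g)\<close>.\<close>

definition symmable :: "('n::finite \<Rightarrow> 'n \<Rightarrow> 'n \<Rightarrow> 'k::field_char_0) \<Rightarrow> ('n list \<Rightarrow> 'k) \<Rightarrow> bool" where
  "symmable C p \<longleftrightarrow> (\<exists>h. finsupp h \<and> (\<lambda>w. p w - xi h w) \<in> lie_ideal C)"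

lemma symmable_ideal: "p \<in> lie_ideal C \<Longrightarrow> symmable C p"
  unfolding symmable_def by (rule exI[of _ "\<lambda>_. 0"]) (simp add: xi_conv)

lemma symmable_xi: "finsupp h \<Longrightarrow> symmable C (xi h)"
  unfolding symmable_def by (rule exI[of _ h]) (simp add: lie_ideal.zero)

lemma symmable_add:
  assumes "symmable C p" "symmable C q"
  shows "symmable C (\<lambda>w. p w + q w)"
proof -
  from assms obtain g h where gh: "finsupp g" "(\<lambda>w. p w - xi g w) \<in> lie_ideal C"
      "finsupp h" "(\<lambda>w. q w - xi h w) \<in> lie_ideal C"
    unfolding symmable_def by blast
  have "(\<lambda>w. p w + q w - xi (\<lambda>m. g m + h m) w) = (\<lambda>w. (p w - xi g w) + (q w - xi h w))"
    by (simp add: xi_conv fun_eq_iff algebra_simps add_divide_distrib)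
  with ideal_add[OF gh(2,4)] gh(1,3) show ?thesis
    unfolding symmable_def by (intro exI[of _ "\<lambda>m. g m + h m"]) (simp add: finsupp_add)
qed

lemma symmable_scale:
  assumes "symmable C p"
  shows "symmable C (\<lambda>w. c * p w)"
proof -
  from assms obtain g where g: "finsupp g" "(\<lambda>w. p w - xi g w) \<in> lie_ideal C"
    unfolding symmable_def by blast
  have "(\<lambda>w. c * p w - xi (\<lambda>m. c * g m) w) = (\<lambda>w. c * (p w - xi g w))"
    by (simp add: xi_conv fun_eq_iff algebra_simps)
  with ideal_scale[OF g(2)] g(1) show ?thesis
    unfolding symmable_def by (intro exI[of _ "\<lambda>m. c * g m"]) (simp add: finsupp_scale)
qed

lemma symmable_sum: "(\<And>x. x \<in> A \<Longrightarrow> symmable C (p x)) \<Longrightarrow> symmable C (\<lambda>w. \<Sum>x\<in>A. p x w)"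
  by (induction A rule: infinite_finite_induct) (auto intro: symmable_add symmable_ideal lie_ideal.zero)

text \<open>Modulo the ideal, exchanging two neighbours changes a word only by shorter words, which
  are covered by the induction on length.\<close>

lemma symmable_swap:
  assumes "\<And>w. length w < n \<Longrightarrow> symmable C (word w)" "length (u @ [i, j] @ v) = n"
  shows "symmable C (\<lambda>w. word (u @ [i, j] @ v) w - word (u @ [j, i] @ v) w)"
proof -
  have "symmable C (\<lambda>w. wprod (wprod (word u) (rel C i j)) (word v) w + (\<Sum>k\<in>UNIV. C i j k * word (u @ [k] @ v) w))"
    using assms by (intro symmable_add[OF symmable_ideal[OF ideal_rel]] symmable_sum symmable_scale) auto
  then show ?thesis by (simp add: wprod_rel)
qed

lemma symmable_trans:
  assumes "symmable C (\<lambda>w. p w - q w)" "symmable C (\<lambda>w. q w - r w)"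
  shows "symmable C (\<lambda>w. p w - r w)"
  using symmable_add[OF assms] by simp

lemma symmable_move:
  assumes "\<And>w. length w < n \<Longrightarrow> symmable C (word w)" "length (q @ u @ x # v) = n"
  shows "symmable C (\<lambda>w. word (q @ u @ x # v) w - word (q @ x # u @ v) w)"
  using assms(2)
proof (induction u arbitrary: q)
  case Nil
  then show ?case by (simp add: symmable_ideal lie_ideal.zero)
next
  case (Cons y u)
  have "symmable C (\<lambda>w. word ((q @ [y]) @ u @ x # v) w - word ((q @ [y]) @ x # u @ v) w)"
    using Cons.prems by (intro Cons.IH) simp
  moreover have "symmable C (\<lambda>w. word (q @ [y, x] @ (u @ v)) w - word (q @ [x, y] @ (u @ v)) w)"
    using Cons.prems by (intro symmable_swap[OF assms(1)]) auto
  ultimately show ?case using symmable_trans by fastforce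
qed

text \<open>The first letter of \<open>u\<close> is located in \<open>v\<close> and moved to the
  front there; the tails are then compared behind a common prefix longer by one letter.\<close>

lemma symmable_perm:
  assumes "\<And>w. length w < n \<Longrightarrow> symmable C (word w)" "length (q @ u) = n" "wmono u = wmono v"
  shows "symmable C (\<lambda>w. word (q @ u) w - word (q @ v) w)"
  using assms(2,3)
proof (induction u arbitrary: q v)
  case Nil
  then have "length v = 0" by (metis mdeg_wmono list.size(3))
  then show ?case by (simp add: symmable_ideal lie_ideal.zero)
next
  case (Cons x u)
  have "0 < wmono v x" unfolding Cons.prems(2)[symmetric] by (simp add: wmono_def)
  then have "x \<in> set v" by (auto simp: wmono_def intro: ccontr)
  then obtain v1 v2 where v: "v = v1 @ x # v2" by (meson split_list)
  have wm: "wmono u = wmono (v1 @ v2)"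
    using Cons.prems(2) unfolding v by (auto simp: wmono_def fun_eq_iff split: if_splits)
  have len: "length u = length (v1 @ v2)" using arg_cong[OF wm, of mdeg] by simp
  have "symmable C (\<lambda>w. word ((q @ [x]) @ u) w - word ((q @ [x]) @ v1 @ v2) w)"
    using Cons.prems wm by (intro Cons.IH) auto
  \<comment> \<open>The factor -1 reverses the difference supplied by \<open>symmable_move\<close>,
    so that the two differences chain.\<close>
  moreover have "symmable C (\<lambda>w. - 1 * (word (q @ v1 @ x # v2) w - word (q @ x # v1 @ v2) w))"
    using Cons.prems len by (intro symmable_scale symmable_move[OF assms(1)]) auto
  ultimately show ?case unfolding v using symmable_trans by fastforce
qed

text \<open>The symmetrized monomial is \<open>c\<close> times the sum of all rearrangements of
  \<open>u\<close>. Replacing each of them by \<open>u\<close> leaves \<open>card ?W * c\<close>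
  copies of \<open>u\<close>, a factor that is nonzero in characteristic 0.\<close>

lemma symmable_word: "symmable C (word u)"
proof (induction "length u" arbitrary: u rule: less_induct)
  case less
  define m where "m = wmono u"
  define c :: 'b where "c = mfact m / fact (mdeg m)"
  let ?W = "{v. wmono v = m}"
  let ?h = "\<lambda>a. if a = m then 1 else 0 :: 'b"
  have W: "finite ?W" "u \<in> ?W" by (auto simp: finite_wmono m_def)
  then have "card ?W \<noteq> 0" by auto
  then have nz: "of_nat (card ?W) * c \<noteq> 0" by (simp add: c_def)
  have "xi ?h w = (\<Sum>v\<in>?W. c * word v w)" for w
  proof -
    have "(\<Sum>v\<in>?W. c * word v w) = (\<Sum>v\<in>?W. if w = v then c else 0)"
      by (intro sum.cong) (auto simp: word_def)
    also have "\<dots> = xi ?h w"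
      using W by (auto simp: xi_conv c_def mdeg_wmono[symmetric] simp del: mdeg_wmono)
    finally show ?thesis ..
  qed
  then have "of_nat (card ?W) * c * word u w = (\<Sum>v\<in>?W. c * (word u w - word v w)) + xi ?h w" for w
    by (simp add: right_diff_distrib sum_subtractf)
  moreover have "symmable C (\<lambda>w. (\<Sum>v\<in>?W. c * (word u w - word v w)) + xi ?h w)"
  proof (intro symmable_add symmable_sum symmable_scale symmable_xi)
    show "symmable C (\<lambda>w. word u w - word v w)" if "v \<in> ?W" for v
      using symmable_perm[of "length u" C "[]" u v] less that by (simp add: m_def)
    show "finsupp ?h" by (rule finsupp_superset[of "{m}"]) (auto split: if_splits)
  qed
  ultimately have "symmable C (\<lambda>w. of_nat (card ?W) * c * word u w)"
    by simp
  from symmable_scale[OF this, of "inverse (of_nat (card ?W) * c)"]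
  have "symmable C (\<lambda>w. inverse (of_nat (card ?W) * c) * (of_nat (card ?W) * c * word u w))" .
  moreover have "inverse (of_nat (card ?W) * c) * (of_nat (card ?W) * c * x) = x" for x
    using nz by (metis mult.assoc left_inverse mult_1)
  ultimately show ?case by (simp only:)
qed

lemma symmable_finsupp:
  assumes "finsupp p" shows "symmable C p"
proof -
  have "p w = (\<Sum>u | p u \<noteq> 0. p u * word u w)" for w
  proof -
    have "(\<Sum>u | p u \<noteq> 0. p u * word u w) = (\<Sum>u | p u \<noteq> 0. if w = u then p u else 0)"
      by (intro sum.cong) (auto simp: word_def)
    then show ?thesis using assms by (simp add: finsupp_def)
  qed
  then have "p = (\<lambda>w. \<Sum>u | p u \<noteq> 0. p u * word u w)" by blast
  moreover have "symmable C (\<lambda>w. \<Sum>u | p u \<noteq> 0. p u * word u w)"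
    by (intro symmable_sum symmable_scale symmable_word)
  ultimately show ?thesis by simp
qed

section \<open>Star multiplication by a variable as a transpose\<close>

lemma xi_xvar: "xi (xvar nu) = (word [nu] :: 'n::finite list \<Rightarrow> 'k::field_char_0)"
proof
  fix w :: "'n list"
  show "xi (xvar nu) w = (word [nu] w :: 'k)"
  proof (cases "wmono w = unitv nu")
    case True
    then have "length w = 1" by (metis mdeg_unitv mdeg_wmono)
    then obtain i where w: "w = [i]" by (auto simp: length_Suc_conv)
    with True have "unitv i = unitv nu" by (simp add: wmono_Cons) (simp add: wmono_def fun_eq_iff)
    then have "unitv i i = unitv nu i" by simp
    then have "w = [nu]" using w by (simp add: unitv_def split: if_splits)
    moreover have "mfact (unitv nu) = (1 :: 'k)"
      using mfact_add_unitv[of 0 nu, where 'k = 'k] by (simp add: mfact_def)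
    ultimately show ?thesis using True by (simp add: xi_conv xvar_def word_def)
  next
    case False
    then have "w \<noteq> [nu]" by (auto simp: wmono_def unitv_def)
    with False show ?thesis by (simp add: xi_conv xvar_def word_def)
  qed
qed

lemma wprod_letter: "wprod (word [i]) q w = (case w of [] \<Rightarrow> 0 | x # v \<Rightarrow> if x = i then q v else 0)"
proof (cases w)
  case Nil
  then show ?thesis by (simp add: wprod_def word_def)
next
  case (Cons x v)
  have "wprod (word [i]) q w = (\<Sum>k\<in>{..length w}. if k = 1 then (if x = i then q v else 0) else 0)"
    unfolding wprod_def
  proof (intro sum.cong refl)
    fix k assume "k \<in> {..length w}"
    then show "word [i] (take k w) * q (drop k w) = (if k = 1 then (if x = i then q v else 0) else 0)"
      using Cons by (cases k) (auto simp: word_def)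
  qed
  also have "\<dots> = (if x = i then q v else 0)"
    using Cons by (subst sum.delta) auto
  finally show ?thesis using Cons by simp
qed

lemma wprod_letter_superset:
  "wprod (word [i]) q w \<noteq> 0 \<Longrightarrow> w \<in> (#) i ` {v. q v \<noteq> 0}"
  by (auto simp: wprod_letter split: list.splits if_splits)

lemma finsupp_wprod_letter: "finsupp q \<Longrightarrow> finsupp (wprod (word [i]) q)"
  by (rule finsupp_superset[OF _ wprod_letter_superset]) (simp_all add: finsupp_def)

lemma wordpair_wprod_letter:
  assumes "finsupp q"
  shows "wordpair C D (wprod (word [i]) q) = wordpair C (starfield C i D) q"
proof -
  have "wordpair C D (wprod (word [i]) q) = (\<Sum>w\<in>(#) i ` {v. q v \<noteq> 0}. wprod (word [i]) q w * coef (wordfield C w D) 0)"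
    unfolding wordpair_def using assms by (intro funpair_superset wprod_letter_superset) (auto simp: finsupp_def)
  also have "\<dots> = wordpair C (starfield C i D) q"
    by (subst sum.reindex) (auto simp: wordpair_def funpair_def wprod_letter)
  finally show ?thesis .
qed

text \<open>The definite description in \<open>star\<close> is justified by surjectivity of
  symmetrization for existence and by nondegeneracy of the pairing for uniqueness.\<close>

lemma star_xvar:
  fixes f :: "('n::finite, 'k::field_char_0) poly"
  assumes lie: "lie_structure C" and f: "finsupp f"
  shows "finsupp (star C (xvar nu) f) \<and> pair D (star C (xvar nu) f) = pair (starfield C nu D) f"
proof -
  let ?p = "wprod (xi (xvar nu)) (xi f)"
  have p: "finsupp ?p" "wordpair C D ?p = pair (starfield C nu D) f" for D
    unfolding xi_xvar using f
    by (simp_all add: finsupp_wprod_letter finsupp_xi wordpair_wprod_letter wordpair_xi[OF lie])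
  \<comment> \<open>Every candidate \<open>h\<close> has these pairings, which settles uniqueness
    and the value at once.\<close>
  have P: "pair D h = pair (starfield C nu D) f"
    if "finsupp h" "(\<lambda>w. ?p w - xi h w) \<in> lie_ideal C" for h D
  proof -
    have "wordpair C D (\<lambda>w. ?p w - xi h w) = 0" using wordpair_ideal[OF lie that(2)] by blast
    then have "wordpair C D ?p - wordpair C D (xi h) = 0"
      unfolding wordpair_def by (simp add: funpair_diff p(1) finsupp_xi that(1))
    then show ?thesis using p(2) wordpair_xi[OF lie that(1)] by simp
  qed
  have "\<exists>!h. h \<in> Spoly \<and> (\<lambda>w. ?p w - xi h w) \<in> lie_ideal C"
    unfolding Spoly_finsupp
  proof (rule ex_ex1I)
    show "\<exists>h. finsupp h \<and> (\<lambda>w. ?p w - xi h w) \<in> lie_ideal C"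
      using symmable_finsupp[OF p(1)] unfolding symmable_def .
  qed (auto intro!: pair_eqI simp: P)
  from theI'[OF this] show ?thesis
    unfolding star_def Spoly_finsupp using P by blast
qed

theorem theorem8p4:
  fixes C :: "'n::finite \<Rightarrow> 'n \<Rightarrow> 'n \<Rightarrow> 'k::field_char_0"
    and f :: "('n, 'k) poly" and mu nu :: 'n
  assumes "lie_structure C"
    and "f \<in> Spoly"
  shows "(\<lambda>m. Mop C mu (star C (xvar nu) f) m - star C (xvar nu) (Mop C mu f) m)
       = (\<lambda>m. (\<Sum>l\<in>UNIV. C mu nu l * mulx l f m)
              + (\<Sum>tau\<in>UNIV. Mop C tau (ps_apply (chi C tau mu nu) f) m))"
proof (rule pair_eqI)
  note lie = assms(1)
  have f: "finsupp f" using assms(2) by (simp add: Spoly_finsupp)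
  have fs: "finsupp (star C (xvar nu) f)" "finsupp (star C (xvar nu) (Mop C mu f))"
    using star_xvar[OF lie f] star_xvar[OF lie finsupp_Mop[OF f]] by auto
  show fl: "finsupp (\<lambda>m. Mop C mu (star C (xvar nu) f) m - star C (xvar nu) (Mop C mu f) m)"
    by (intro finsupp_diff finsupp_Mop fs)
  have fr: "finsupp (\<lambda>m. \<Sum>l\<in>UNIV. C mu nu l * mulx l f m)"
    "finsupp (\<lambda>m. \<Sum>tau\<in>UNIV. Mop C tau (ps_apply (chi C tau mu nu) f) m)"
    by (intro finsupp_sum finsupp_scale finsupp_mulx finsupp_Mop finsupp_ps_apply f)+
  then show "finsupp (\<lambda>m. (\<Sum>l\<in>UNIV. C mu nu l * mulx l f m)
              + (\<Sum>tau\<in>UNIV. Mop C tau (ps_apply (chi C tau mu nu) f) m))"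
    by (rule finsupp_add)
  fix D
  have "pair D (\<lambda>m. Mop C mu (star C (xvar nu) f) m - star C (xvar nu) (Mop C mu f) m)
      = pair D (Mop C mu (star C (xvar nu) f)) - pair D (star C (xvar nu) (Mop C mu f))"
    unfolding pair_def by (intro funpair_diff finsupp_Mop fs)
  \<comment> \<open>Transposition reverses the order of composition.\<close>
  also have "\<dots> = pair (starfield C nu (adfield C mu D) - adfield C mu (starfield C nu D)) f"
    using star_xvar[OF lie f] star_xvar[OF lie finsupp_Mop[OF f]]
    by (simp add: pair_Mop fs f pair_diff_left)
  \<comment> \<open>The commutator is replaced by its value from \<open>chi_adfield\<close>; both
    summands are then transposed back into operators on \<open>f\<close>.\<close>
  also have "\<dots> = pair (\<Sum>l\<in>UNIV. mconst (C mu nu l) * mderiv l D) f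
      + pair (\<Sum>tau\<in>UNIV. Mps (chi C tau mu nu) * adfield C tau D) f"
    unfolding chi_adfield[OF lie] by (simp add: pair_diff_left)
  also have "pair (\<Sum>l\<in>UNIV. mconst (C mu nu l) * mderiv l D) f = pair D (\<lambda>m. \<Sum>l\<in>UNIV. C mu nu l * mulx l f m)"
    using pair_mulx[OF f] f
    by (simp add: pair_sum_left pair_mconst_left pair_def[of D] funpair_sum funpair_scale finsupp_scale finsupp_mulx) (simp add: pair_def)
  also have "pair (\<Sum>tau\<in>UNIV. Mps (chi C tau mu nu) * adfield C tau D) f
      = pair D (\<lambda>m. \<Sum>tau\<in>UNIV. Mop C tau (ps_apply (chi C tau mu nu) f) m)"
  proof -
    have "pair D (\<lambda>m. \<Sum>tau\<in>UNIV. Mop C tau (ps_apply (chi C tau mu nu) f) m)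
       = (\<Sum>tau\<in>UNIV. pair D (Mop C tau (ps_apply (chi C tau mu nu) f)))"
      unfolding pair_def by (intro funpair_sum finsupp_Mop finsupp_ps_apply f)
    then show ?thesis
      by (simp add: pair_Mop pair_ps_apply finsupp_ps_apply f pair_sum_left)
  qed
  finally show "pair D (\<lambda>m. Mop C mu (star C (xvar nu) f) m - star C (xvar nu) (Mop C mu f) m)
      = pair D (\<lambda>m. (\<Sum>l\<in>UNIV. C mu nu l * mulx l f m)
              + (\<Sum>tau\<in>UNIV. Mop C tau (ps_apply (chi C tau mu nu) f) m))"
    unfolding pair_def funpair_add[OF fr] .
qed

end
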